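(* Let $\alpha,\gamma,\rho,a\in\mathbb{C}$ with $a\ne0$, and let $\mu$ be a real number, such that $\operatorname{Re}(\alpha)>0$, $\mu>0$ and $\operatorname{Re}(\rho)>\max\{0,\operatorname{Re}(-\gamma)\}$. Then the right-sided Erdélyi–Kober fractional integral $\mathcal{K}_{\gamma,\alpha}^{-}=\mathcal{I}_{-}^{\alpha,0,\gamma}$ satisfies, for every $x>0$, $$\left(\mathcal{K}_{\gamma,\alpha}^{-}\left(t^{-\rho}I^{m,n}_{p,q}\left[at^{-\mu}\,\middle|\begin{matrix}(a_i,A_i,\alpha_i)_{1,p}\\(b_j,B_j,\beta_j)_{1,q}\end{matrix}\right]\right)\right)(x)=x^{-\rho}\,I^{m,n+1}_{p+1,q+1}\left[ax^{-\mu}\,\middle|\begin{matrix}(1-\gamma-\rho,\mu,1),\ (a_i,A_i,\alpha_i)_{1,p}\\(b_j,B_j,\beta_j)_{1,q},\ (1-\alpha-\gamma-\rho,\mu,1)\end{matrix}\right].$$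
   Context: **$I$-function.** Let $m,n,p,q$ be integers with $0\le m\le q$, $0\le n\le p$; let $a_i\in\mathbb{C}$, $A_i,\alpha_i>0$ $(1\le i\le p)$ and $b_j\in\mathbb{C}$, $B_j,\beta_j>0$ $(1\le j\le q)$. For $z\neq0$ (with a chosen value of $\arg z$; $z^{-s}=e^{-s(\log|z|+i\arg z)}$), $$I^{m,n}_{p,q}\left[z\,\middle|\begin{matrix}(a_i,A_i,\alpha_i)_{1,p}\\(b_j,B_j,\beta_j)_{1,q}\end{matrix}\right]=\frac{1}{2\pi i}\int_{C}\chi(s)z^{-s}\,ds,\qquad \chi(s)=\frac{\prod_{j=1}^{m}\Gamma^{\beta_j}(b_j+B_js)\prod_{i=1}^{n}\Gamma^{\alpha_i}(1-a_i-A_is)}{\prod_{j=m+1}^{q}\Gamma^{\beta_j}(1-b_j-B_js)\prod_{i=n+1}^{p}\Gamma^{\alpha_i}(a_i+A_is)}.$$ Here $(a_i,A_i,\alpha_i)_{1,p}$ is the ordered list of triples for $i=1,\dots,p$ (the first $n$ upper triples and the first $m$ lower triples enter the numerator), $\Gamma^{\kappa}(w)=(\Gamma(w))^{\kappa}$, with the branch of non-integer powers fixed along $C$ and the same for the same triple in all $I$-functions considered; empty products equal $1$. The singularities of $\Gamma^{\beta_j}(b_j+B_js)$, $j\le m$, lie to the left of $C$ and those of $\Gamma^{\alpha_i}(1-a_i-A_is)$, $i\le n$, to the right. **Standing assumptions.** The contour $C$ is the imaginary axis $\operatorname{Re}(s)=0$, traversed upwards, and for each $I$-function occurring the following conditions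 for absolute convergence hold: with (computed from the parameters of that $I$-function) $\mu^*=\sum_{j=1}^q\beta_jB_j-\sum_{i=1}^p\alpha_iA_i$, $\Omega=\sum_{i=1}^p(\frac12-\operatorname{Re}(a_i))\alpha_i-\sum_{j=1}^q(\frac12-\operatorname{Re}(b_j))\beta_j$, $\Delta=\sum_{j=1}^m\beta_jB_j-\sum_{j=m+1}^q\beta_jB_j+\sum_{i=1}^n\alpha_iA_i-\sum_{i=n+1}^p\alpha_iA_i$, either $\Delta>0$ and $|\arg z|<\frac{\pi}{2}\Delta$, or $\Delta\ge0$, $|\arg z|=\frac{\pi}{2}\Delta$ and one of: $\mu^*=0$ and $\Omega<-1$; or $\mu^*\ne0$ and $\Omega+\sigma\mu^*<-1$ where $\sigma=\operatorname{Re}(s)$ on $C$ (so $\sigma=0$). For $t>0$, $\arg(at^{\pm\mu})=\arg a$. **Operator.** For $\operatorname{Re}(\alpha)>0$, $x>0$, the right-sided Saigo fractional integral is $$\left(\mathcal{I}_{-}^{\alpha,\beta,\gamma}f\right)(x)=\frac{1}{\Gamma(\alpha)}\int_x^{\infty}(t-x)^{\alpha-1}t^{-\alpha-\beta}{}_{2}F_1\left(\alpha+\beta,-\gamma;\alpha;1-\tfrac{x}{t}\right)f(t)\,dt,$$ and $\mathcal{K}_{\gamma,\alpha}^{-}:=\mathcal{I}_{-}^{\alpha,0,\gamma}$. *)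

theory Defs
  imports "HOL-Analysis.Analysis"
begin

section \<open>Powers of the Gamma function along the contour\<close>

definition contour :: "complex set" where
  "contour = {s. Re s = 0}"

text \<open>
  A non-integer power $\Gamma^\kappa(c + d s)$ is $\exp(\kappa \cdot \ell(s))$ for a continuous
  logarithm $\ell$ of $\Gamma(c + d s)$ along the contour. All these logarithms are collected in
  one function \<open>L\<close>, keyed by \<open>(c, d, \<kappa>)\<close>, so that the same triple in the
  same role gets the same branch in every I-function formed with \<open>L\<close>. In the denominator a
  pole of $\Gamma(c + d s)$ may lie on the contour; no logarithm exists at such a point.
\<close>

type_synonym gamma_log = "complex \<times> real \<times> real \<Rightarrow> complex \<Rightarrow> complex"

definition is_gamma_log :: "gamma_log \<Rightarrow> bool" where
  "is_gamma_log L \<longleftrightarrow> (\<forall>c d \<kappa>.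
     let S = {s \<in> contour. c + of_real d * s \<notin> \<int>\<^sub>\<le>\<^sub>0} in
       continuous_on S (L (c, d, \<kappa>)) \<and>
       (\<forall>s\<in>S. exp (L (c, d, \<kappa>) s) = Gamma (c + of_real d * s)))"

text \<open>
  \<open>Gamma_pow L c d \<kappa> s\<close> is $\Gamma^\kappa(c + d s)$. The value 0 at the poles follows the
  library convention for \<open>Gamma\<close>; with \<open>inverse 0 = 0\<close> it gives
  $1/\Gamma^\kappa = 0$ there, which is the correct value for $\kappa > 0$.
\<close>

definition Gamma_pow :: "gamma_log \<Rightarrow> complex \<Rightarrow> real \<Rightarrow> real \<Rightarrow> complex \<Rightarrow> complex" where
  "Gamma_pow L c d \<kappa> s =
     (if c + of_real d * s \<in> \<int>\<^sub>\<le>\<^sub>0 then 0 else exp (of_real \<kappa> * L (c, d, \<kappa>) s))"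


section \<open>The I-function\<close>

text \<open>
  Throughout, \<open>us\<close> is the list of upper triples $(a_i, A_i, \alpha_i)$ and \<open>ls\<close> the list of
  lower triples $(b_j, B_j, \beta_j)$; thus $p$ and $q$ are their lengths.
\<close>

type_synonym triple = "complex \<times> real \<times> real"

definition I_chi :: "gamma_log \<Rightarrow> nat \<Rightarrow> nat \<Rightarrow> triple list \<Rightarrow> triple list \<Rightarrow> complex \<Rightarrow> complex" where
  "I_chi L m n us ls s =
     ((\<Prod>(b, B, \<beta>)\<leftarrow>take m ls. Gamma_pow L b B \<beta> s) *
      (\<Prod>(a, A, \<alpha>)\<leftarrow>take n us. Gamma_pow L (1 - a) (- A) \<alpha> s)) /
     ((\<Prod>(b, B, \<beta>)\<leftarrow>drop m ls. Gamma_pow L (1 - b) (- B) \<beta> s) *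
      (\<Prod>(a, A, \<alpha>)\<leftarrow>drop n us. Gamma_pow L a A \<alpha> s))"

text \<open>
  The argument \<open>\<theta>\<close> is the chosen value of $\arg z$. The contour is parametrised by $s = iy$,
  $ds = i\,dy$.
\<close>

definition I_function ::
    "gamma_log \<Rightarrow> nat \<Rightarrow> nat \<Rightarrow> triple list \<Rightarrow> triple list \<Rightarrow> complex \<Rightarrow> real \<Rightarrow> complex" where
  "I_function L m n us ls z \<theta> =
     1 / (2 * of_real pi * \<i>) *
     (\<integral>y. (let s = \<i> * of_real y in
             I_chi L m n us ls s * exp (- s * (of_real (ln (norm z)) + \<i> * of_real \<theta>)) * \<i>) \<partial>lborel)"

definition I_mu :: "triple list \<Rightarrow> triple list \<Rightarrow> real" where
  "I_mu us ls = (\<Sum>(b, B, \<beta>)\<leftarrow>ls. \<beta> * B) - (\<Sum>(a, A, \<alpha>)\<leftarrow>us. \<alpha> * A)"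

definition I_Omega :: "triple list \<Rightarrow> triple list \<Rightarrow> real" where
  "I_Omega us ls =
     (\<Sum>(a, A, \<alpha>)\<leftarrow>us. (1/2 - Re a) * \<alpha>) - (\<Sum>(b, B, \<beta>)\<leftarrow>ls. (1/2 - Re b) * \<beta>)"

definition I_Delta :: "nat \<Rightarrow> nat \<Rightarrow> triple list \<Rightarrow> triple list \<Rightarrow> real" where
  "I_Delta m n us ls =
     (\<Sum>(b, B, \<beta>)\<leftarrow>take m ls. \<beta> * B) - (\<Sum>(b, B, \<beta>)\<leftarrow>drop m ls. \<beta> * B) +
     (\<Sum>(a, A, \<alpha>)\<leftarrow>take n us. \<alpha> * A) - (\<Sum>(a, A, \<alpha>)\<leftarrow>drop n us. \<alpha> * A)"

definition I_parameters :: "nat \<Rightarrow> nat \<Rightarrow> triple list \<Rightarrow> triple list \<Rightarrow> bool" where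
  "I_parameters m n us ls \<longleftrightarrow>
     m \<le> length ls \<and> n \<le> length us \<and>
     (\<forall>(a, A, \<alpha>)\<in>set us. A > 0 \<and> \<alpha> > 0) \<and>
     (\<forall>(b, B, \<beta>)\<in>set ls. B > 0 \<and> \<beta> > 0)"

text \<open>The contour runs upwards along the imaginary axis, so ``left of it'' means \<open>Re s < 0\<close>.\<close>

definition I_separated :: "nat \<Rightarrow> nat \<Rightarrow> triple list \<Rightarrow> triple list \<Rightarrow> bool" where
  "I_separated m n us ls \<longleftrightarrow>
     (\<forall>(b, B, \<beta>)\<in>set (take m ls). \<forall>s. b + of_real B * s \<in> \<int>\<^sub>\<le>\<^sub>0 \<longrightarrow> Re s < 0) \<and>
     (\<forall>(a, A, \<alpha>)\<in>set (take n us). \<forall>s. 1 - a - of_real A * s \<in> \<int>\<^sub>\<le>\<^sub>0 \<longrightarrow> Re s > 0)"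

definition I_convergent :: "nat \<Rightarrow> nat \<Rightarrow> triple list \<Rightarrow> triple list \<Rightarrow> real \<Rightarrow> bool" where
  "I_convergent m n us ls \<theta> \<longleftrightarrow>
     (let \<mu> = I_mu us ls; \<Omega> = I_Omega us ls; \<Delta> = I_Delta m n us ls in
        (\<Delta> > 0 \<and> \<bar>\<theta>\<bar> < pi / 2 * \<Delta>) \<or>
        (\<Delta> \<ge> 0 \<and> \<bar>\<theta>\<bar> = pi / 2 * \<Delta> \<and>
          ((\<mu> = 0 \<and> \<Omega> < -1) \<or>
           (\<mu> \<noteq> 0 \<and> (\<forall>s\<in>contour. \<Omega> + Re s * \<mu> < -1)))))"

definition I_admissible :: "nat \<Rightarrow> nat \<Rightarrow> triple list \<Rightarrow> triple list \<Rightarrow> real \<Rightarrow> bool" where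
  "I_admissible m n us ls \<theta> \<longleftrightarrow>
     I_parameters m n us ls \<and> I_separated m n us ls \<and> I_convergent m n us ls \<theta>"


section \<open>Right-sided Saigo and Erdelyi--Kober fractional integrals\<close>

text \<open>The power series suffices: the argument $1 - x/t$ lies in $[0, 1)$ for $t \ge x > 0$.\<close>

definition hyp2F1 :: "complex \<Rightarrow> complex \<Rightarrow> complex \<Rightarrow> complex \<Rightarrow> complex" where
  "hyp2F1 a b c z = eval_fps (fps_hypergeo [a, b] [c] 1) z"

definition saigo_right_integrand ::
    "complex \<Rightarrow> complex \<Rightarrow> complex \<Rightarrow> (real \<Rightarrow> complex) \<Rightarrow> real \<Rightarrow> real \<Rightarrow> complex" where
  "saigo_right_integrand \<alpha> \<beta> \<gamma> f x t =
     of_real (t - x) powr (\<alpha> - 1) * of_real t powr (- \<alpha> - \<beta>) *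
     hyp2F1 (\<alpha> + \<beta>) (- \<gamma>) \<alpha> (of_real (1 - x / t)) * f t"

definition saigo_right_exists ::
    "complex \<Rightarrow> complex \<Rightarrow> complex \<Rightarrow> (real \<Rightarrow> complex) \<Rightarrow> real \<Rightarrow> bool" where
  "saigo_right_exists \<alpha> \<beta> \<gamma> f x \<longleftrightarrow>
     set_integrable lborel {x<..} (saigo_right_integrand \<alpha> \<beta> \<gamma> f x)"

definition saigo_right ::
    "complex \<Rightarrow> complex \<Rightarrow> complex \<Rightarrow> (real \<Rightarrow> complex) \<Rightarrow> real \<Rightarrow> complex" where
  "saigo_right \<alpha> \<beta> \<gamma> f x =
     1 / Gamma \<alpha> * set_lebesgue_integral lborel {x<..} (saigo_right_integrand \<alpha> \<beta> \<gamma> f x)"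

definition erdelyi_kober_right_exists ::
    "complex \<Rightarrow> complex \<Rightarrow> (real \<Rightarrow> complex) \<Rightarrow> real \<Rightarrow> bool" where
  "erdelyi_kober_right_exists \<gamma> \<alpha> = saigo_right_exists \<alpha> 0 \<gamma>"

definition erdelyi_kober_right ::
    "complex \<Rightarrow> complex \<Rightarrow> (real \<Rightarrow> complex) \<Rightarrow> real \<Rightarrow> complex" where
  "erdelyi_kober_right \<gamma> \<alpha> = saigo_right \<alpha> 0 \<gamma>"

end

theory Submission
  imports Defs "HOL-Real_Asymp.Real_Asymp"
begin

text \<open>
  An I-function is a superposition of powers: with $s = iy$ it integrates $\chi(s)\, z^{-s}$ over the
  real \<open>y\<close>, and at $z = a t^{-\mu}$ the dependence on \<open>t\<close> is the single factor
  $t^{\mu s}$. An Erdelyi--Kober integral maps powers to multiples of themselves. Indeed, for second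
  parameter \<open>0\<close> the hypergeometric kernel collapses to $(x/t)^\gamma$
  (\<open>hyp2F1_cancel\<close>), and the Beta integral (\<open>has_bochner_integral_Beta_right\<close>) gives
  \[ \frac{1}{\Gamma(\alpha)} \int_x^\infty (t - x)^{\alpha - 1}\, t^{-\alpha}\, (x/t)^\gamma\,
     t^{-\rho + \mu s}\, dt
     = x^{-\rho + \mu s}\, \frac{\Gamma(\gamma + \rho - \mu s)}{\Gamma(\alpha + \gamma + \rho - \mu s)}. \]
  The two Gamma factors are exactly the ones that the additional upper and lower triple contribute to
  $\chi$ (\<open>I_chi_extend\<close>). The conditions on $\rho$ make the exponent
  $\gamma + \rho - \mu s$ have positive real part everywhere on the contour.

  What remains is the interchange of the two integrals
  (\<open>has_bochner_integral_Beta_superposition\<close>). As $t^{\mu s}$ has modulus 1 on the contour, this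
  only needs absolute convergence of the contour integral (\<open>integrable_I_chi\<close>), and here the
  convergence conditions enter: by \<open>norm_I_chi_bigtheta\<close>, $|\chi(iy)|$ is of exact order
  $|y|^\Omega e^{-\pi \Delta |y| / 2}$.

  This rests on the order of $|\Gamma(\sigma + i\tau)|$ for large $\tau$, which is
  $\tau^{\sigma - 1/2} e^{-\pi\tau/2}$ (\<open>norm_Gamma_vertical_bigtheta\<close>). It is obtained without
  Stirling's formula. For $\sigma = 0$ the reflection formula gives the modulus in closed form. For
  $\sigma$ in the unit interval, $\log |\Gamma(\sigma + i\tau)|$ differs from the linear interpolation
  between $\sigma = 0$ and $\sigma = 1$ by a bounded amount, which can be read off Gauss's product
  (\<open>ln_norm_Gamma_strip\<close>). The functional equation carries the result to all $\sigma$.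
\<close>

section \<open>The binomial case of the hypergeometric series\<close>

lemma not_nonpos_Int_if_Re_pos: "Re z > 0 \<Longrightarrow> z \<notin> \<int>\<^sub>\<le>\<^sub>0"
  by (auto elim!: nonpos_Ints_cases)

text \<open>
  With \<open>c\<close> both an upper and the lower parameter the Pochhammer factors cancel and
  Newton's binomial series is left. This is why the Saigo kernel with second parameter \<open>0\<close>
  is elementary.
\<close>

lemma hyp2F1_cancel:
  fixes b c z :: complex
  assumes c: "c \<notin> \<int>\<^sub>\<le>\<^sub>0" and z: "norm z < 1"
  shows "hyp2F1 c b c z = (1 - z) powr (- b)"
proof -
  have "fps_nth (fps_hypergeo [c, b] [c] 1) k * z ^ k = ((- b) gchoose k) * (- z) ^ k" for k
  proof -
    have "pochhammer c k \<noteq> 0"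
      using c by (auto simp: pochhammer_eq_0_iff)
    then show ?thesis
      by (simp add: gbinomial_pochhammer power_minus[of z] field_simps)
  qed
  moreover have "(\<lambda>k. ((- b) gchoose k) * (- z) ^ k) sums (1 + - z) powr (- b)"
    using z by (intro gen_binomial_complex) auto
  ultimately show ?thesis
    by (simp add: hyp2F1_def eval_fps_def sums_iff)
qed

section \<open>Euler integrals with complex parameters\<close>

text \<open>
  The logarithm jumps across the negative axis, so the power is not continuous in the base. On the
  real line the jump is confined to \<open>0\<close>, and each of the three pieces is measurable.
\<close>

lemma borel_measurable_of_real_powr [measurable (raw)]:
  fixes f :: "'a \<Rightarrow> real" and z :: complex
  assumes [measurable]: "f \<in> borel_measurable M"
  shows "(\<lambda>x. of_real (f x) powr z) \<in> borel_measurable M"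
proof -
  have "Ln (of_real t) = of_real (ln (- t)) + \<i> * of_real pi" if "t < 0" for t :: real
    using that Ln_minus[of "of_real (- t)"] Ln_of_real[of "- t"] by (auto simp: add.commute)
  then have "of_real t powr z = (if t > 0 then exp (z * of_real (ln t)) else if t = 0 then 0
      else exp (z * (of_real (ln (- t)) + \<i> * of_real pi)))" for t :: real
    by (auto simp: powr_def Ln_of_real)
  then show ?thesis
    by simp
qed

text \<open>
  Euler's integral after the substitution \<open>t \<mapsto> v t\<close>, as a Bochner integral so that
  the theorem of Fubini applies to it.
\<close>

lemma has_bochner_integral_Gamma:
  fixes z :: complex and v :: real
  assumes z: "Re z > 0" and v: "v > 0"
  shows "has_bochner_integral lborel
           (\<lambda>t. indicator {0<..} t *\<^sub>R (of_real t powr (z - 1) * of_real (exp (- (v * t)))))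
           (Gamma z * of_real v powr (- z))"
proof -
  let ?h = "\<lambda>t. indicator {0<..} t *\<^sub>R (of_real t powr (z - 1) / of_real (exp t)) :: complex"
  have meas: "?h \<in> borel_measurable lborel"
    by measurable
  have "integrable (completion lborel) ?h"
    using absolutely_integrable_Gamma_integral'[OF z] by (simp add: set_integrable_def)
  then have int: "integrable lborel ?h"
    using meas by (simp add: integrable_completion)
  have "(LINT t:{0<..}|lborel. of_real t powr (z - 1) / of_real (exp t)) = Gamma z"
    using set_borel_integral_eq_integral(2)[of "{0<..}" "\<lambda>t. of_real t powr (z - 1) / of_real (exp t)"]
      int Gamma_integral_complex'[OF z] by (simp add: set_integrable_def integral_unique)
  then have "has_bochner_integral lborel ?h (Gamma z)"
    using int by (simp add: has_bochner_integral_iff set_lebesgue_integral_def)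
  then have "has_bochner_integral lborel (\<lambda>t. ?h (0 + v * t)) (Gamma z /\<^sub>R \<bar>v\<bar>)"
    using v by (subst lborel_has_bochner_integral_real_affine_iff[symmetric]) auto
  then have "has_bochner_integral lborel (\<lambda>t. of_real v powr (1 - z) * ?h (v * t))
       (of_real v powr (1 - z) * (Gamma z /\<^sub>R v))"
    using v by (intro has_bochner_integral_mult_right) simp
  moreover have "of_real v powr (1 - z) * ?h (v * t) =
       indicator {0<..} t *\<^sub>R (of_real t powr (z - 1) * of_real (exp (- (v * t))))" for t
  proof (cases "t > 0")
    case True
    have "of_real v powr (1 - z) * (of_real v * of_real t) powr (z - 1) =
        exp ((1 - z) * of_real (ln v)) * exp ((z - 1) * (of_real (ln v) + of_real (ln t)))"
      using v True by (simp add: powr_def Ln_of_real ln_mult flip: of_real_mult)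
    also have "\<dots> = of_real t powr (z - 1)"
      using True by (simp add: powr_def Ln_of_real algebra_simps flip: exp_add)
    finally show ?thesis
      using v True by (simp add: exp_minus field_simps flip: exp_of_real)
  qed (use v in \<open>auto simp: indicator_def zero_less_mult_iff\<close>)
  moreover have "of_real v powr (1 - z) * (Gamma z /\<^sub>R v) = Gamma z * of_real v powr (- z)"
    using v by (simp add: powr_diff powr_minus scaleR_conv_of_real field_simps)
  ultimately show ?thesis by simp
qed

lemma has_bochner_integral_Gamma_shifted:
  fixes z :: complex and v x :: real
  assumes "Re z > 0" and "v > 0"
  shows "has_bochner_integral lborel
           (\<lambda>t. indicator {x<..} t *\<^sub>R (of_real (t - x) powr (z - 1) * of_real (exp (- (v * t)))))
           (Gamma z * of_real v powr (- z) * of_real (exp (- (v * x))))"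
proof -
  let ?h = "\<lambda>t. indicator {0<..} t *\<^sub>R (of_real t powr (z - 1) * of_real (exp (- (v * t)))) :: complex"
  have "has_bochner_integral lborel (\<lambda>t. ?h (- x + 1 * t)) (Gamma z * of_real v powr (- z) /\<^sub>R \<bar>1\<bar>)"
    using has_bochner_integral_Gamma[OF assms]
    by (subst lborel_has_bochner_integral_real_affine_iff[symmetric]) auto
  then have "has_bochner_integral lborel (\<lambda>t. ?h (t - x) * of_real (exp (- (v * x))))
      (Gamma z * of_real v powr (- z) * of_real (exp (- (v * x))))"
    by (intro has_bochner_integral_mult_left) (simp add: add.commute)
  moreover have "?h (t - x) * of_real (exp (- (v * x))) =
     indicator {x<..} t *\<^sub>R (of_real (t - x) powr (z - 1) * of_real (exp (- (v * t))))" for t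
    by (auto simp: indicator_def algebra_simps simp flip: exp_of_real exp_add)
  ultimately show ?thesis by simp
qed

text \<open>
  For real exponent the integrand is its own absolute value, so this is the preceding integral at
  \<open>Re z\<close>. It provides the absolute convergence in the next proof.
\<close>

lemma norm_integral_Gamma_shifted:
  fixes z :: complex and v x :: real
  assumes z: "Re z > 0" and v: "v > 0"
  shows "(\<integral>t. norm (indicator {x<..} t *\<^sub>R
             (of_real (t - x) powr (z - 1) * of_real (exp (- (v * t)))) :: complex) \<partial>lborel) =
         Gamma (Re z) * v powr (- Re z) * exp (- (v * x))"
proof -
  have "complex_of_real (\<integral>t. norm (indicator {x<..} t *\<^sub>R
             (of_real (t - x) powr (z - 1) * of_real (exp (- (v * t)))) :: complex) \<partial>lborel) =
      (\<integral>t. indicator {x<..} t *\<^sub>R (of_real (t - x) powr (of_real (Re z) - 1) *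
           of_real (exp (- (v * t)))) \<partial>lborel)"
    unfolding integral_complex_of_real[symmetric]
  proof (intro Bochner_Integration.integral_cong refl)
    fix t :: real
    have "of_real (t - x) powr (of_real (Re z) - 1) = complex_of_real ((t - x) powr (Re z - 1))" if "t > x"
      using that powr_of_real[of "t - x" "Re z - 1"] by simp
    then show "complex_of_real (norm (indicator {x<..} t *\<^sub>R
             (of_real (t - x) powr (z - 1) * of_real (exp (- (v * t)))) :: complex)) =
         indicator {x<..} t *\<^sub>R (of_real (t - x) powr (of_real (Re z) - 1) * of_real (exp (- (v * t))))"
      by (auto simp: indicator_def norm_mult norm_powr_real_powr simp del: of_real_diff)
  qed
  also have "\<dots> = Gamma (of_real (Re z)) * of_real v powr (- of_real (Re z)) * of_real (exp (- (v * x)))"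
    using has_bochner_integral_Gamma_shifted[of "of_real (Re z)" v x] z v
    by (simp add: has_bochner_integral_iff)
  also have "\<dots> = of_real (Gamma (Re z) * v powr (- Re z) * exp (- (v * x)))"
    using v by (simp add: Gamma_complex_of_real powr_of_real flip: of_real_minus)
  finally show ?thesis
    by (simp only: of_real_eq_iff)
qed

text \<open>
  The Beta integral with complex parameters on a half-line. Inserting
  $\Gamma(\alpha + w)\, t^{-\alpha - w} = \int_0^\infty v^{\alpha + w - 1} e^{-tv}\, dv$ and
  integrating over \<open>t\<close> first leaves
  $\Gamma(\alpha) \int_0^\infty v^{w - 1} e^{-xv}\, dv = \Gamma(\alpha) \Gamma(w) x^{-w}$.
  Both orders of integration thus reduce to Euler's integral, which is available for complex
  parameters.
\<close>

lemma has_bochner_integral_Beta_right: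
  fixes \<alpha> w :: complex and x :: real
  assumes \<alpha>: "Re \<alpha> > 0" and w: "Re w > 0" and x: "x > 0"
  shows "has_bochner_integral lborel
           (\<lambda>t. indicator {x<..} t *\<^sub>R (of_real (t - x) powr (\<alpha> - 1) * of_real t powr (- \<alpha> - w)))
           (of_real x powr (- w) * (Gamma \<alpha> * Gamma w / Gamma (\<alpha> + w)))"
proof -
  let ?p = "\<lambda>v. indicator {0<..} v *\<^sub>R of_real v powr (\<alpha> + w - 1) :: complex"
  let ?q = "\<lambda>v t. indicator {x<..} t *\<^sub>R (of_real (t - x) powr (\<alpha> - 1) * of_real (exp (- (v * t)))) :: complex"
  define F where "F = (\<lambda>v t. ?p v * ?q v t)"
  have inner_t: "has_bochner_integral lborel (F v)
      (Gamma \<alpha> * (indicator {0<..} v *\<^sub>R (of_real v powr (w - 1) * of_real (exp (- (x * v))))))" for v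
  proof (cases "v > 0")
    case True
    have "has_bochner_integral lborel (F v)
       (?p v * (Gamma \<alpha> * of_real v powr (- \<alpha>) * of_real (exp (- (v * x)))))"
      unfolding F_def
      by (intro has_bochner_integral_mult_right has_bochner_integral_Gamma_shifted \<alpha> True)
    also have "?p v * (Gamma \<alpha> * of_real v powr (- \<alpha>) * of_real (exp (- (v * x)))) =
      Gamma \<alpha> * (indicator {0<..} v *\<^sub>R (of_real v powr (w - 1) * of_real (exp (- (x * v)))))"
      using True by (simp add: powr_add powr_diff powr_minus field_simps)
    finally show ?thesis .
  qed (auto simp: F_def)
  have norm_t: "(\<integral>t. norm (F v t) \<partial>lborel) = Gamma (Re \<alpha>) *
      norm (indicator {0<..} v *\<^sub>R (of_real v powr (w - 1) * of_real (exp (- (x * v)))) :: complex)" for v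
  proof (cases "v > 0")
    case True
    have "(\<integral>t. norm (F v t) \<partial>lborel) = norm (?p v) * (\<integral>t. norm (?q v t) \<partial>lborel)"
      unfolding F_def norm_mult[of "?p v"] by (rule integral_mult_right_zero)
    also have "\<dots> = norm (?p v) * (Gamma (Re \<alpha>) * v powr (- Re \<alpha>) * exp (- (v * x)))"
      by (subst norm_integral_Gamma_shifted) (use \<alpha> True in auto)
    also have "\<dots> = Gamma (Re \<alpha>) *
       norm (indicator {0<..} v *\<^sub>R (of_real v powr (w - 1) * of_real (exp (- (x * v)))) :: complex)"
      using True by (simp add: norm_mult norm_powr_real_powr norm_divide powr_add powr_diff powr_minus field_simps)
    finally show ?thesis .
  qed (auto simp: F_def)
  have inner_v: "has_bochner_integral lborel (\<lambda>v. F v t)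
      (Gamma (\<alpha> + w) * (indicator {x<..} t *\<^sub>R (of_real (t - x) powr (\<alpha> - 1) * of_real t powr (- \<alpha> - w))))" for t
  proof (cases "t > x")
    case True
    then have "has_bochner_integral lborel (\<lambda>v. of_real (t - x) powr (\<alpha> - 1) *
        (indicator {0<..} v *\<^sub>R (of_real v powr (\<alpha> + w - 1) * of_real (exp (- (t * v))))))
        (of_real (t - x) powr (\<alpha> - 1) * (Gamma (\<alpha> + w) * of_real t powr (- (\<alpha> + w))))"
      using \<alpha> w x by (intro has_bochner_integral_mult_right has_bochner_integral_Gamma) auto
    then show ?thesis
      using True by (simp add: F_def mult_ac)
  qed (auto simp: F_def)
  have [measurable]: "case_prod F \<in> borel_measurable (lborel \<Otimes>\<^sub>M lborel)"
    unfolding F_def by measurable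
  have outer: "has_bochner_integral lborel
      (\<lambda>v. indicator {0<..} v *\<^sub>R (of_real v powr (w - 1) * of_real (exp (- (x * v)))))
      (Gamma w * of_real x powr (- w))"
    by (intro has_bochner_integral_Gamma w x)
  have int: "integrable (lborel \<Otimes>\<^sub>M lborel) (case_prod F)"
  proof (rule lborel_pair.Fubini_integrable)
    show "integrable lborel (\<lambda>v. \<integral>t. norm (case_prod F (v, t)) \<partial>lborel)"
      using outer unfolding prod.case norm_t
      by (intro integrable_mult_right integrable_norm) (simp add: has_bochner_integral_iff)
    show "AE v in lborel. integrable lborel (\<lambda>t. case_prod F (v, t))"
      using inner_t by (auto simp: has_bochner_integral_iff)
  qed auto
  let ?k = "\<lambda>t. indicator {x<..} t *\<^sub>R (of_real (t - x) powr (\<alpha> - 1) * of_real t powr (- \<alpha> - w)) :: complex"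
  have nz: "Gamma (\<alpha> + w) \<noteq> 0"
    using \<alpha> w by (intro Gamma_nonzero not_nonpos_Int_if_Re_pos) auto
  have "integrable lborel (\<lambda>t. Gamma (\<alpha> + w) * ?k t)"
    using lborel_pair.integrable_snd[OF int] inner_v by (simp add: has_bochner_integral_iff)
  then have "integrable lborel (\<lambda>t. inverse (Gamma (\<alpha> + w)) * (Gamma (\<alpha> + w) * ?k t))"
    by (rule integrable_mult_right)
  then have intk: "integrable lborel ?k"
    using nz unfolding mult.assoc[symmetric] left_inverse[OF nz] by simp
  have "Gamma (\<alpha> + w) * (\<integral>t. ?k t \<partial>lborel) = (\<integral>t. (\<integral>v. F v t \<partial>lborel) \<partial>lborel)"
    unfolding has_bochner_integral_integral_eq[OF inner_v]
    by (rule integral_mult_right_zero[symmetric])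
  also have "\<dots> = (\<integral>v. (\<integral>t. F v t \<partial>lborel) \<partial>lborel)"
    using lborel_pair.Fubini_integral[OF int] by simp
  also have "\<dots> = Gamma \<alpha> * (Gamma w * of_real x powr (- w))"
    unfolding has_bochner_integral_integral_eq[OF inner_t] integral_mult_right_zero
      has_bochner_integral_integral_eq[OF outer] ..
  finally have "(\<integral>t. ?k t \<partial>lborel) = of_real x powr (- w) * (Gamma \<alpha> * Gamma w / Gamma (\<alpha> + w))"
    using nz by (simp add: field_simps)
  with intk show ?thesis
    by (simp add: has_bochner_integral_iff)
qed

section \<open>Growth of the Gamma function along vertical lines\<close>

text \<open>
  Here \<open>f x\<close> is the logarithm of $|k + x + i \tau|$. Its second derivative is the real part
  of $-1/(k + x + i\tau)^2$, hence at most \<open>1 / (k\<^sup>2 + 1)\<close> in absolute value for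
  \<open>x \<ge> 0\<close>, and this controls the distance of \<open>f\<close> from its chord on the unit
  interval. What matters is that the bound does not depend on \<open>\<tau>\<close> and is summable over \<open>k\<close>.
\<close>

lemma ln_quadratic_interpolation:
  fixes k \<tau> \<sigma> :: real
  assumes k: "k \<ge> 0" and \<tau>: "\<tau> \<ge> 1" and \<sigma>: "0 \<le> \<sigma>" "\<sigma> \<le> 1"
  defines "f \<equiv> \<lambda>x. ln ((k + x)\<^sup>2 + \<tau>\<^sup>2) / 2"
  shows "\<bar>f \<sigma> - ((1 - \<sigma>) * f 0 + \<sigma> * f 1)\<bar> \<le> 1 / (k\<^sup>2 + 1)"
proof -
  define M where "M = 1 / (k\<^sup>2 + 1)"
  define D where "D = (\<lambda>x. (k + x)\<^sup>2 + \<tau>\<^sup>2)"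
  define f' where "f' = (\<lambda>x. (k + x) / D x)"
  define f'' where "f'' = (\<lambda>x. (\<tau>\<^sup>2 - (k + x)\<^sup>2) / (D x)\<^sup>2)"
  have \<tau>2: "\<tau>\<^sup>2 \<ge> 1"
    using \<tau> by (simp add: power2_eq_square mult_ge1_I)
  have D_pos: "D x > 0" for x
    unfolding D_def using \<tau> by (intro add_nonneg_pos) auto
  have df: "(f has_real_derivative f' x) (at x)" for x
    unfolding f_def f'_def using D_pos[of x]
    by (auto intro!: derivative_eq_intros simp: D_def divide_simps algebra_simps)
  have df': "(f' has_real_derivative f'' x) (at x)" for x
    unfolding f'_def f''_def D_def using D_pos[of x]
    by (auto intro!: derivative_eq_intros simp: D_def field_simps power2_eq_square)
  have bound: "\<bar>f'' x\<bar> \<le> M" if "x \<in> {0..1}" for x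
  proof -
    have "\<bar>f'' x\<bar> = \<bar>\<tau>\<^sup>2 - (k + x)\<^sup>2\<bar> / (D x)\<^sup>2"
      by (simp add: f''_def)
    also have "\<dots> \<le> D x / (D x)\<^sup>2"
      by (intro divide_right_mono) (auto simp: D_def abs_le_iff)
    also have "\<dots> = 1 / D x"
      using D_pos[of x] by (simp add: power2_eq_square)
    also have "\<dots> \<le> M"
      unfolding M_def D_def using that k \<tau>2
      by (intro divide_left_mono add_mono power_mono mult_pos_pos add_nonneg_pos) auto
    finally show ?thesis .
  qed
  have nonneg: "0 \<le> M + f'' x" "0 \<le> M - f'' x" if "x \<in> {0..1}" for x
    using bound[OF that] by (simp_all add: abs_le_iff)
  \<comment> \<open>Since \<open>M\<close> bounds the second derivative, adding or subtracting \<open>f\<close> keeps the parabola convex.\<close>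
  have "convex_on {0..1} (\<lambda>x. M * x\<^sup>2 / 2 + f x)"
    by (intro f''_ge0_imp_convex[where f' = "\<lambda>x. M * x + f' x" and f'' = "\<lambda>x. M + f'' x"])
       (use nonneg in \<open>auto intro!: derivative_eq_intros df df'\<close>)
  from convex_onD[OF this, of \<sigma> 0 1] have "f \<sigma> - ((1 - \<sigma>) * f 0 + \<sigma> * f 1) \<le> M * (\<sigma> - \<sigma>\<^sup>2) / 2"
    using \<sigma> by (simp add: algebra_simps)
  moreover have "convex_on {0..1} (\<lambda>x. M * x\<^sup>2 / 2 - f x)"
    by (intro f''_ge0_imp_convex[where f' = "\<lambda>x. M * x - f' x" and f'' = "\<lambda>x. M - f'' x"])
       (use nonneg in \<open>auto intro!: derivative_eq_intros df df'\<close>)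
  from convex_onD[OF this, of \<sigma> 0 1] have "((1 - \<sigma>) * f 0 + \<sigma> * f 1) - f \<sigma> \<le> M * (\<sigma> - \<sigma>\<^sup>2) / 2"
    using \<sigma> by (simp add: algebra_simps)
  moreover have "M * (\<sigma> - \<sigma>\<^sup>2) / 2 \<le> M"
  proof -
    have "M \<ge> 0" by (simp add: M_def)
    moreover have "\<sigma> - \<sigma>\<^sup>2 \<le> 2" using \<sigma> by (smt (verit) zero_le_power2)
    ultimately show ?thesis using mult_left_mono[of "\<sigma> - \<sigma>\<^sup>2" 2 M] by simp
  qed
  ultimately show ?thesis
    unfolding M_def by linarith
qed

lemma summable_inverse_square_plus_1: "summable (\<lambda>k. 1 / ((real k)\<^sup>2 + 1))"
proof (rule summable_comparison_test')
  show "summable (\<lambda>k. inverse ((real k)\<^sup>2))"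
    by (rule inverse_power_summable) simp
  show "norm (1 / ((real k)\<^sup>2 + 1)) \<le> inverse ((real k)\<^sup>2)" if "k \<ge> 1" for k
    using that by (simp add: inverse_eq_divide frac_le)
qed

text \<open>
  The approximants of Gauss's product formula. Up to terms affine in \<open>\<sigma>\<close>, the logarithm is
  a sum of the functions treated above.
\<close>

lemma ln_norm_Gamma_series:
  assumes "\<tau> > 0" and "n > 0"
  shows "ln (norm (Gamma_series (Complex \<sigma> \<tau>) n)) =
           ln (fact n) + \<sigma> * ln (real n) - (\<Sum>k\<le>n. ln ((real k + \<sigma>)\<^sup>2 + \<tau>\<^sup>2) / 2)"
proof -
  have norm_add: "norm (Complex \<sigma> \<tau> + of_nat k) = sqrt ((real k + \<sigma>)\<^sup>2 + \<tau>\<^sup>2)" for k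
    by (simp add: cmod_def add.commute)
  have pos: "(real k + \<sigma>)\<^sup>2 + \<tau>\<^sup>2 > 0" for k
    using assms by (intro add_nonneg_pos) auto
  have "norm (Gamma_series (Complex \<sigma> \<tau>) n) =
      fact n * exp (\<sigma> * ln (real n)) / (\<Prod>k\<le>n. sqrt ((real k + \<sigma>)\<^sup>2 + \<tau>\<^sup>2))"
    unfolding Gamma_series_def
    by (simp add: norm_divide norm_mult norm_fact pochhammer_Suc_prod atMost_atLeast0
        norm_add flip: prod_norm)
  also have "ln \<dots> = ln (fact n) + \<sigma> * ln (real n) - (\<Sum>k\<le>n. ln (sqrt ((real k + \<sigma>)\<^sup>2 + \<tau>\<^sup>2)))"
  proof -
    have sqrt_pos: "sqrt ((real k + \<sigma>)\<^sup>2 + \<tau>\<^sup>2) > 0" for k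
      using pos by simp
    then have "(\<Prod>k\<le>n. sqrt ((real k + \<sigma>)\<^sup>2 + \<tau>\<^sup>2)) > 0"
      by (intro prod_pos) auto
    moreover have "ln (\<Prod>k\<le>n. sqrt ((real k + \<sigma>)\<^sup>2 + \<tau>\<^sup>2)) =
        (\<Sum>k\<le>n. ln (sqrt ((real k + \<sigma>)\<^sup>2 + \<tau>\<^sup>2)))"
      using sqrt_pos by (intro ln_prod) auto
    moreover have "ln (fact n * exp E / P) = ln (fact n) + E - ln P" if "P > 0" for E P :: real
      using that by (simp add: ln_div ln_mult)
    ultimately show ?thesis
      by simp
  qed
  finally show ?thesis
    using pos by (simp add: ln_sqrt)
qed

text \<open>
  Affine functions of \<open>\<sigma>\<close> are reproduced by linear interpolation, so in Gauss's product
  only the linear factors contribute an interpolation error, and these errors have a bounded sum.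
  The right end of the interval is tied to the left one by
  $\Gamma(1 + i\tau) = i\tau\, \Gamma(i\tau)$.
\<close>

lemma ln_norm_Gamma_strip:
  assumes \<sigma>: "0 \<le> \<sigma>" "\<sigma> \<le> 1" and \<tau>: "\<tau> \<ge> 1"
  shows "\<bar>ln (norm (Gamma (Complex \<sigma> \<tau>))) - ln (norm (Gamma (Complex 0 \<tau>))) - \<sigma> * ln \<tau>\<bar>
           \<le> (\<Sum>k. 1 / ((real k)\<^sup>2 + 1))"
proof -
  define K where "K = (\<Sum>k. 1 / ((real k)\<^sup>2 + 1))"
  define l where "l = (\<lambda>\<sigma> n. ln (norm (Gamma_series (Complex \<sigma> \<tau>) n)))"
  define f where "f = (\<lambda>k x. ln ((real k + x)\<^sup>2 + \<tau>\<^sup>2) / 2)"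
  have noninteger: "Complex \<sigma> \<tau> \<notin> \<int>\<^sub>\<le>\<^sub>0" for \<sigma>
    using \<tau> by (auto elim!: nonpos_Ints_cases simp: complex_eq_iff)
  have nz: "Gamma (Complex \<sigma> \<tau>) \<noteq> 0" for \<sigma>
    using noninteger by (simp add: Gamma_eq_zero_iff)
  have lim: "l \<sigma> \<longlonglongrightarrow> ln (norm (Gamma (Complex \<sigma> \<tau>)))" for \<sigma>
    unfolding l_def using nz by (intro tendsto_intros) auto
  have "\<bar>l \<sigma> n - ((1 - \<sigma>) * l 0 n + \<sigma> * l 1 n)\<bar> \<le> K" if n: "n > 0" for n
  proof -
    have "l \<sigma> n - ((1 - \<sigma>) * l 0 n + \<sigma> * l 1 n) =
        - (\<Sum>k\<le>n. f k \<sigma> - ((1 - \<sigma>) * f k 0 + \<sigma> * f k 1))"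
      unfolding l_def f_def using n \<tau>
      by (simp add: ln_norm_Gamma_series sum_subtractf sum.distrib sum_distrib_left algebra_simps)
    also have "\<bar>\<dots>\<bar> \<le> (\<Sum>k\<le>n. \<bar>f k \<sigma> - ((1 - \<sigma>) * f k 0 + \<sigma> * f k 1)\<bar>)"
      unfolding abs_minus_cancel by (rule sum_abs)
    also have "\<dots> \<le> (\<Sum>k\<le>n. 1 / ((real k)\<^sup>2 + 1))"
      unfolding f_def using \<sigma> \<tau> by (intro sum_mono ln_quadratic_interpolation) auto
    also have "\<dots> \<le> K"
      unfolding K_def by (intro sum_le_suminf summable_inverse_square_plus_1) auto
    finally show ?thesis .
  qed
  then have "eventually (\<lambda>n. \<bar>l \<sigma> n - ((1 - \<sigma>) * l 0 n + \<sigma> * l 1 n)\<bar> \<le> K) sequentially"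
    by (auto intro: eventually_mono[OF eventually_gt_at_top[of 0]])
  then have "\<bar>ln (norm (Gamma (Complex \<sigma> \<tau>))) - ((1 - \<sigma>) * ln (norm (Gamma (Complex 0 \<tau>))) +
      \<sigma> * ln (norm (Gamma (Complex 1 \<tau>))))\<bar> \<le> K"
    by (intro tendsto_upperbound[where F = sequentially and
          f = "\<lambda>n. \<bar>l \<sigma> n - ((1 - \<sigma>) * l 0 n + \<sigma> * l 1 n)\<bar>"] tendsto_intros lim) auto
  moreover have "ln (norm (Gamma (Complex 1 \<tau>))) = ln \<tau> + ln (norm (Gamma (Complex 0 \<tau>)))"
  proof -
    have "Complex 1 \<tau> = Complex 0 \<tau> + 1"
      by (simp add: complex_eq_iff)
    then have "Gamma (Complex 1 \<tau>) = Complex 0 \<tau> * Gamma (Complex 0 \<tau>)"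
      using Gamma_plus1[OF noninteger] by simp
    moreover have "norm (Complex 0 \<tau>) = \<tau>"
      using \<tau> by (simp add: cmod_def)
    ultimately show ?thesis
      using \<tau> nz[of 0] by (simp add: norm_mult ln_mult)
  qed
  ultimately show ?thesis
    by (simp add: K_def algebra_simps)
qed

text \<open>
  The reflection formula, in which $\Gamma(-i\tau)$ is the conjugate of
  $\Gamma(i\tau)$; the fraction with the exponentials is $\sinh(\pi\tau)$.
\<close>

lemma norm_Gamma_imaginary:
  assumes "\<tau> > 0"
  shows "norm (Gamma (Complex 0 \<tau>)) = sqrt (pi / (\<tau> * ((exp (pi * \<tau>) - exp (- (pi * \<tau>))) / 2)))"
proof -
  define z where "z = Complex 0 \<tau>"
  have z: "z = \<i> * of_real \<tau>"
    by (simp add: z_def complex_eq_iff)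
  have "norm z = \<tau>"
    using assms by (simp add: z norm_mult)
  moreover have "norm (sin (of_real pi * z)) = (exp (pi * \<tau>) - exp (- (pi * \<tau>))) / 2"
  proof -
    have "sin (of_real pi * z) = of_real ((exp (- (pi * \<tau>)) - exp (pi * \<tau>)) / 2) / \<i>"
      unfolding sin_exp_eq z by (simp add: mult_ac field_simps exp_of_real flip: exp_of_real of_real_mult)
    also have "norm \<dots> = \<bar>(exp (- (pi * \<tau>)) - exp (pi * \<tau>)) / 2\<bar>"
      unfolding norm_divide norm_of_real by simp
    finally show ?thesis
      using assms by simp
  qed
  moreover have "(norm (Gamma z))\<^sup>2 = norm (Gamma z * Gamma (- z))"
  proof -
    have "- z = cnj z" by (simp add: z)
    then have "norm (Gamma (- z)) = norm (Gamma z)"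
      by (metis cnj_Gamma complex_mod_cnj)
    then show ?thesis
      by (simp add: norm_mult power2_eq_square)
  qed
  ultimately have "(norm (Gamma z))\<^sup>2 = pi / (\<tau> * ((exp (pi * \<tau>) - exp (- (pi * \<tau>))) / 2))"
    by (simp only: Gamma_reflection_complex' norm_divide norm_mult norm_minus_cancel norm_of_real
        abs_of_pos[OF pi_gt_zero])
  then show ?thesis
    unfolding z_def by (metis norm_ge_zero real_sqrt_unique)
qed

lemma norm_Gamma_imaginary_bigtheta:
  "(\<lambda>\<tau>. norm (Gamma (Complex 0 \<tau>))) \<in> \<Theta>(\<lambda>\<tau>. \<tau> powr (- 1 / 2) * exp (- (pi / 2 * \<tau>)))"
proof -
  have "(\<lambda>\<tau>. norm (Gamma (Complex 0 \<tau>))) \<in>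
      \<Theta>(\<lambda>\<tau>. sqrt (pi / (\<tau> * ((exp (pi * \<tau>) - exp (- (pi * \<tau>))) / 2))))"
    by (intro bigthetaI_cong eventually_mono[OF eventually_gt_at_top[of 0]] norm_Gamma_imaginary)
  also have "(\<lambda>\<tau>. sqrt (pi / (\<tau> * ((exp (pi * \<tau>) - exp (- (pi * \<tau>))) / 2)))) \<in>
      \<Theta>(\<lambda>\<tau>::real. \<tau> powr (- 1 / 2) * exp (- (pi / 2 * \<tau>)))"
    by real_asymp
  finally show ?thesis .
qed

lemma norm_Gamma_strip_bigtheta:
  assumes \<sigma>: "0 \<le> \<sigma>" "\<sigma> \<le> 1"
  shows "(\<lambda>\<tau>. norm (Gamma (Complex \<sigma> \<tau>))) \<in> \<Theta>(\<lambda>\<tau>. \<tau> powr (\<sigma> - 1 / 2) * exp (- (pi / 2 * \<tau>)))"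
proof -
  define K where "K = (\<Sum>k. 1 / ((real k)\<^sup>2 + 1))"
  have "(\<lambda>\<tau>. norm (Gamma (Complex \<sigma> \<tau>))) \<in> \<Theta>(\<lambda>\<tau>. norm (Gamma (Complex 0 \<tau>)) * \<tau> powr \<sigma>)"
  proof (rule bigthetaI'[of "exp (- K)" "exp K"])
    show "eventually (\<lambda>\<tau>. exp (- K) * norm (norm (Gamma (Complex 0 \<tau>)) * \<tau> powr \<sigma>) \<le> norm (norm (Gamma (Complex \<sigma> \<tau>))) \<and>
        norm (norm (Gamma (Complex \<sigma> \<tau>))) \<le> exp K * norm (norm (Gamma (Complex 0 \<tau>)) * \<tau> powr \<sigma>)) at_top"
      using eventually_ge_at_top[of 1]
    proof eventually_elim
      case (elim \<tau>)
      define g where "g = (\<lambda>\<sigma>. ln (norm (Gamma (Complex \<sigma> \<tau>))))"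
      have "Complex \<sigma> \<tau> \<notin> \<int>\<^sub>\<le>\<^sub>0" for \<sigma>
        using elim by (auto elim!: nonpos_Ints_cases simp: complex_eq_iff)
      then have g: "norm (Gamma (Complex \<sigma> \<tau>)) = exp (g \<sigma>)" for \<sigma>
        unfolding g_def by (simp add: Gamma_nonzero)
      have "\<bar>g \<sigma> - g 0 - \<sigma> * ln \<tau>\<bar> \<le> K"
        unfolding g_def K_def by (intro ln_norm_Gamma_strip \<sigma> elim)
      moreover have "\<tau> powr \<sigma> = exp (\<sigma> * ln \<tau>)"
        using elim by (simp add: powr_def)
      ultimately show ?case
        by (simp add: g abs_le_iff flip: exp_add)
    qed
  qed auto
  also have "(\<lambda>\<tau>. norm (Gamma (Complex 0 \<tau>)) * \<tau> powr \<sigma>) \<in>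
      \<Theta>(\<lambda>\<tau>. (\<tau> powr (- 1 / 2) * exp (- (pi / 2 * \<tau>))) * \<tau> powr \<sigma>)"
    by (intro landau_theta.mult norm_Gamma_imaginary_bigtheta) simp
  also have "(\<lambda>\<tau>. (\<tau> powr (- 1 / 2) * exp (- (pi / 2 * \<tau>))) * \<tau> powr \<sigma>) \<in>
      \<Theta>(\<lambda>\<tau>. \<tau> powr (\<sigma> - 1 / 2) * exp (- (pi / 2 * \<tau>)))"
    by (intro bigthetaI_cong always_eventually) (simp add: powr_add[of _ "- 1/2" \<sigma>, simplified] mult_ac)
  finally show ?thesis .
qed

text \<open>
  By the functional equation the modulus gains the factor $|\sigma + i\tau|$, which is of the same
  exact order \<open>\<tau>\<close> as the quotient of the comparison functions. The equivalence allows steps in both directions from the unit strip.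
\<close>

lemma norm_Gamma_shift_bigtheta:
  "(\<lambda>\<tau>. norm (Gamma (Complex (\<sigma> + 1) \<tau>))) \<in>
     \<Theta>(\<lambda>\<tau>. \<tau> powr (\<sigma> + 1 - 1 / 2) * exp (- (pi / 2 * \<tau>))) \<longleftrightarrow>
   (\<lambda>\<tau>. norm (Gamma (Complex \<sigma> \<tau>))) \<in> \<Theta>(\<lambda>\<tau>. \<tau> powr (\<sigma> - 1 / 2) * exp (- (pi / 2 * \<tau>)))"
  (is "?f1 \<in> \<Theta>(?g1) \<longleftrightarrow> ?f \<in> \<Theta>(?g)")
proof -
  have "?f1 \<in> \<Theta>(\<lambda>\<tau>. norm (Complex \<sigma> \<tau>) * ?f \<tau>)"
  proof (intro bigthetaI_cong eventually_mono[OF eventually_gt_at_top[of 0]])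
    fix \<tau> :: real assume "\<tau> > 0"
    then have "Complex \<sigma> \<tau> \<notin> \<int>\<^sub>\<le>\<^sub>0"
      by (auto elim!: nonpos_Ints_cases simp: complex_eq_iff)
    then have "Gamma (Complex \<sigma> \<tau> + 1) = Complex \<sigma> \<tau> * Gamma (Complex \<sigma> \<tau>)"
      by (rule Gamma_plus1)
    moreover have "Complex \<sigma> \<tau> + 1 = Complex (\<sigma> + 1) \<tau>"
      by (simp add: complex_eq_iff)
    ultimately show "?f1 \<tau> = norm (Complex \<sigma> \<tau>) * ?f \<tau>"
      by (simp add: norm_mult)
  qed
  also have "(\<lambda>\<tau>. norm (Complex \<sigma> \<tau>)) \<in> \<Theta>(\<lambda>\<tau>. \<tau>)"
    unfolding complex_norm by real_asymp
  then have "(\<lambda>\<tau>. norm (Complex \<sigma> \<tau>) * ?f \<tau>) \<in> \<Theta>(\<lambda>\<tau>. \<tau> * ?f \<tau>)"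
    by (intro landau_theta.mult) auto
  finally have f1: "?f1 \<in> \<Theta>(\<lambda>\<tau>. \<tau> * ?f \<tau>)" .
  have g1: "?g1 \<in> \<Theta>(\<lambda>\<tau>. \<tau> * ?g \<tau>)"
    by real_asymp
  have "?f1 \<in> \<Theta>(?g1) \<longleftrightarrow> (\<lambda>\<tau>. \<tau> * ?f \<tau>) \<in> \<Theta>(\<lambda>\<tau>. \<tau> * ?g \<tau>)"
    using f1 g1 by (meson bigtheta_sym landau_theta.trans)
  also have "\<dots> \<longleftrightarrow> ?f \<in> \<Theta>(?g)"
    by (rule landau_theta.mult_cancel_left) (auto intro: eventually_mono[OF eventually_gt_at_top[of 0]])
  finally show ?thesis .
qed

lemma norm_Gamma_vertical_bigtheta:
  "(\<lambda>\<tau>. norm (Gamma (Complex \<sigma> \<tau>))) \<in> \<Theta>(\<lambda>\<tau>. \<tau> powr (\<sigma> - 1 / 2) * exp (- (pi / 2 * \<tau>)))"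
proof -
  define P where "P = (\<lambda>\<sigma>. (\<lambda>\<tau>. norm (Gamma (Complex \<sigma> \<tau>))) \<in>
      \<Theta>(\<lambda>\<tau>. \<tau> powr (\<sigma> - 1 / 2) * exp (- (pi / 2 * \<tau>))))"
  have shift: "P (\<sigma> + 1) \<longleftrightarrow> P \<sigma>" for \<sigma>
    unfolding P_def by (rule norm_Gamma_shift_bigtheta)
  have "P (frac \<sigma> + of_int k)" for k
  proof (induction k rule: int_induct[where k = 0])
    case base
    then show ?case
      unfolding P_def using frac_lt_1[of \<sigma>] by (intro norm_Gamma_strip_bigtheta) auto
  next
    case (step1 k)
    then show ?case
      using shift[of "frac \<sigma> + of_int k"] by (simp add: add_ac)
  next
    case (step2 k)
    then show ?case
      using shift[of "frac \<sigma> + of_int (k - 1)"] by (simp add: add_ac)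
  qed
  from this[of "\<lfloor>\<sigma>\<rfloor>"] show ?thesis
    by (simp add: P_def frac_def)
qed

text \<open>
  The exact order of Stirling's formula along a vertical line traversed with velocity
  \<open>d\<close>. The offset \<open>Im c\<close> only changes constants, and a negative velocity is turned into a positive one by complex conjugation.
\<close>

lemma norm_Gamma_line_bigtheta:
  fixes c :: complex and d :: real
  assumes "d \<noteq> 0"
  shows "(\<lambda>y. norm (Gamma (c + of_real d * (\<i> * of_real y)))) \<in>
           \<Theta>(\<lambda>y. y powr (Re c - 1 / 2) * exp (- (pi / 2 * \<bar>d\<bar> * y)))"
proof -
  have upward: "(\<lambda>y. norm (Gamma (c + of_real d * (\<i> * of_real y)))) \<in>
           \<Theta>(\<lambda>y. y powr (Re c - 1 / 2) * exp (- (pi / 2 * d * y)))" if d: "d > 0" for c d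
  proof -
    have "filterlim (\<lambda>y. Im c + d * y) at_top at_top"
      using d by real_asymp
    from landau_theta.compose[OF norm_Gamma_vertical_bigtheta[of "Re c"] this]
    have "(\<lambda>y. norm (Gamma (Complex (Re c) (Im c + d * y)))) \<in>
       \<Theta>(\<lambda>y. (Im c + d * y) powr (Re c - 1 / 2) * exp (- (pi / 2 * (Im c + d * y))))" .
    also have "(\<lambda>y. (Im c + d * y) powr (Re c - 1 / 2) * exp (- (pi / 2 * (Im c + d * y)))) \<in>
       \<Theta>(\<lambda>y. y powr (Re c - 1 / 2) * exp (- (pi / 2 * d * y)))"
      using d by real_asymp
    also have "(\<lambda>y. Complex (Re c) (Im c + d * y)) = (\<lambda>y. c + of_real d * (\<i> * of_real y))"
      by (simp add: complex_eq_iff fun_eq_iff)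
    finally show ?thesis .
  qed
  show ?thesis
  proof (cases "d > 0")
    case True
    then show ?thesis using upward[of d c] by simp
  next
    case False
    have "norm (Gamma (c + of_real d * (\<i> * of_real y))) =
        norm (Gamma (cnj c + of_real (- d) * (\<i> * of_real y)))" for y
    proof -
      have "cnj c + of_real (- d) * (\<i> * of_real y) = cnj (c + of_real d * (\<i> * of_real y))"
        by simp
      then show ?thesis
        by (metis cnj_Gamma complex_mod_cnj)
    qed
    then show ?thesis
      using upward[of "- d" "cnj c"] False assms by simp
  qed
qed

section \<open>The integrand of the I-function on the contour\<close>

lemma imaginary_in_contour [simp]: "\<i> * of_real y \<in> contour"
  by (simp add: contour_def)

text \<open>
  The exponent \<open>\<kappa>\<close> is real, so the absolute value does not depend on the chosen branch. At
  a pole both sides are \<open>0\<close> by convention.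
\<close>

lemma norm_Gamma_pow:
  assumes L: "is_gamma_log L" and s: "s \<in> contour"
  shows "norm (Gamma_pow L c d \<kappa> s) = norm (Gamma (c + of_real d * s)) powr \<kappa>"
proof (cases "c + of_real d * s \<in> \<int>\<^sub>\<le>\<^sub>0")
  case True
  then show ?thesis
    by (simp add: Gamma_pow_def Gamma_eq_zero_iff)
next
  case False
  then have "Gamma (c + of_real d * s) = exp (L (c, d, \<kappa>) s)"
    using L s unfolding is_gamma_log_def Let_def by auto
  then show ?thesis
    using False by (simp add: Gamma_pow_def powr_def)
qed

text \<open>
  The branch is continuous away from the poles, and these form a closed set.
\<close>

lemma Gamma_pow_measurable:
  assumes L: "is_gamma_log L"
  shows "(\<lambda>y. Gamma_pow L c d \<kappa> (\<i> * of_real y)) \<in> borel_measurable borel"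
proof -
  define A where "A = (\<lambda>y::real. c + of_real d * (\<i> * of_real y)) -` (\<int>\<^sub>\<le>\<^sub>0 :: complex set)"
  have "closed A"
    unfolding A_def by (intro closed_vimage closed_nonpos_Ints continuous_intros)
  then have "A \<in> sets borel"
    by (rule borel_closed)
  moreover have "continuous_on (- A) (\<lambda>y. exp (of_real \<kappa> * L (c, d, \<kappa>) (\<i> * of_real y)))"
  proof -
    define S where "S = {s \<in> contour. c + of_real d * s \<notin> \<int>\<^sub>\<le>\<^sub>0}"
    have "continuous_on S (L (c, d, \<kappa>))"
      using L unfolding is_gamma_log_def Let_def S_def by blast
    then have "continuous_on (- A) (\<lambda>y. L (c, d, \<kappa>) (\<i> * of_real y))"
      by (rule continuous_on_compose2) (auto intro!: continuous_intros simp: S_def A_def)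
    then show ?thesis
      by (intro continuous_intros)
  qed
  ultimately have "(\<lambda>y. if y \<in> A then 0 else exp (of_real \<kappa> * L (c, d, \<kappa>) (\<i> * of_real y))) \<in> borel_measurable borel"
    by (intro borel_measurable_continuous_on_if) auto
  then show ?thesis
    by (simp add: Gamma_pow_def A_def)
qed

lemma prod_list_measurable:
  fixes g :: "'a \<Rightarrow> 'b \<Rightarrow> complex"
  assumes "\<And>t. g t \<in> borel_measurable M"
  shows "(\<lambda>y. \<Prod>t\<leftarrow>ts. g t y) \<in> borel_measurable M"
  using assms by (induction ts) auto

lemma I_chi_measurable:
  assumes "is_gamma_log L"
  shows "(\<lambda>y. I_chi L m n us ls (\<i> * of_real y)) \<in> borel_measurable borel"
  unfolding I_chi_def
  by (intro borel_measurable_divide borel_measurable_times prod_list_measurable)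
     (auto intro!: Gamma_pow_measurable assms split: prod.splits)

lemma continuous_on_prod_list:
  fixes g :: "'a \<Rightarrow> 'b::topological_space \<Rightarrow> 'c::{real_normed_algebra_1, comm_monoid_mult}"
  assumes "\<And>t. t \<in> set ts \<Longrightarrow> continuous_on S (g t)"
  shows "continuous_on S (\<lambda>y. \<Prod>t\<leftarrow>ts. g t y)"
  using assms by (induction ts) (auto intro!: continuous_intros)

lemma norm_prod_list:
  fixes g :: "'a \<Rightarrow> 'b::{real_normed_field}"
  shows "norm (\<Prod>t\<leftarrow>ts. g t) = (\<Prod>t\<leftarrow>ts. norm (g t))"
  by (induction ts) (auto simp: norm_mult)

lemma continuous_on_norm_Gamma_pow:
  assumes L: "is_gamma_log L" and "\<And>s. s \<in> contour \<Longrightarrow> c + of_real d * s \<notin> \<int>\<^sub>\<le>\<^sub>0"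
  shows "continuous_on UNIV (\<lambda>y. norm (Gamma_pow L c d \<kappa> (\<i> * of_real y)))"
proof -
  have "c + of_real d * (\<i> * of_real y) \<notin> \<int>\<^sub>\<le>\<^sub>0" for y
    using assms(2) by simp
  then show ?thesis
    unfolding norm_Gamma_pow[OF L imaginary_in_contour]
    by (intro continuous_on_powr continuous_on_norm continuous_intros
          continuous_on_compose2[OF continuous_on_Gamma[of "- \<int>\<^sub>\<le>\<^sub>0"]])
       (auto simp: Gamma_eq_zero_iff)
qed

text \<open>
  Poles on the contour are harmless in the denominator: the reciprocal Gamma function is entire, and
  a positive power of its absolute value stays continuous at its zeros.
\<close>

lemma continuous_on_inverse_norm_Gamma_pow:
  assumes L: "is_gamma_log L" and \<kappa>: "\<kappa> > 0"
  shows "continuous_on UNIV (\<lambda>y. inverse (norm (Gamma_pow L c d \<kappa> (\<i> * of_real y))))"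
proof -
  have "inverse (norm (Gamma_pow L c d \<kappa> (\<i> * of_real y))) =
      norm (rGamma (c + of_real d * (\<i> * of_real y))) powr \<kappa>" for y
    unfolding norm_Gamma_pow[OF L imaginary_in_contour] rGamma_inverse_Gamma
    by (simp add: norm_inverse inverse_powr)
  then show ?thesis
    using \<kappa>
    by (simp only:) (intro continuous_on_powr' continuous_on_norm continuous_intros
          continuous_on_compose2[OF continuous_on_rGamma[of UNIV]]; simp)
qed

text \<open>
  Taking absolute values removes the branches, whose logarithms have no limits at the poles of the
  denominator. Separation of the poles by the contour is what makes the numerator factors continuous.
\<close>

lemma continuous_on_norm_I_chi:
  assumes L: "is_gamma_log L" and par: "I_parameters m n us ls" and sep: "I_separated m n us ls"
  shows "continuous_on UNIV (\<lambda>y. norm (I_chi L m n us ls (\<i> * of_real y)))"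
proof -
  have eq: "norm (I_chi L m n us ls s) =
     (\<Prod>t\<leftarrow>take m ls. norm (case t of (b, B, \<beta>) \<Rightarrow> Gamma_pow L b B \<beta> s)) *
     (\<Prod>t\<leftarrow>take n us. norm (case t of (a, A, \<alpha>) \<Rightarrow> Gamma_pow L (1 - a) (- A) \<alpha> s)) *
     ((\<Prod>t\<leftarrow>drop m ls. inverse (norm (case t of (b, B, \<beta>) \<Rightarrow> Gamma_pow L (1 - b) (- B) \<beta> s))) *
      (\<Prod>t\<leftarrow>drop n us. inverse (norm (case t of (a, A, \<alpha>) \<Rightarrow> Gamma_pow L a A \<alpha> s))))" for s
  proof -
    have inv: "(\<Prod>t\<leftarrow>ts. inverse (g t)) = inverse (\<Prod>t\<leftarrow>ts. g t)" for g :: "triple \<Rightarrow> real" and ts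
      by (induction ts) auto
    show ?thesis
      unfolding I_chi_def inv norm_divide norm_mult norm_prod_list
      by (simp add: divide_inverse)
  qed
  show ?thesis
    unfolding eq
  proof (intro continuous_on_mult continuous_on_prod_list)
    fix t assume t: "t \<in> set (take m ls)"
    obtain b B \<beta> where fields: "t = (b, B, \<beta>)"
      by (cases t)
    have "b + of_real B * s \<notin> \<int>\<^sub>\<le>\<^sub>0" if "s \<in> contour" for s
      using sep t that unfolding I_separated_def contour_def fields by force
    then show "continuous_on UNIV (\<lambda>y. norm (case t of (b, B, \<beta>) \<Rightarrow> Gamma_pow L b B \<beta> (\<i> * of_real y)))"
      unfolding fields prod.case by (rule continuous_on_norm_Gamma_pow[OF L])
  next
    fix t assume t: "t \<in> set (take n us)"
    obtain a A \<alpha> where fields: "t = (a, A, \<alpha>)"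
      by (cases t)
    have "1 - a - of_real A * s \<notin> \<int>\<^sub>\<le>\<^sub>0" if "s \<in> contour" for s
      using sep t that unfolding I_separated_def contour_def fields by force
    then have "1 - a + of_real (- A) * s \<notin> \<int>\<^sub>\<le>\<^sub>0" if "s \<in> contour" for s
      using that by simp
    then show "continuous_on UNIV (\<lambda>y. norm (case t of (a, A, \<alpha>) \<Rightarrow> Gamma_pow L (1 - a) (- A) \<alpha> (\<i> * of_real y)))"
      unfolding fields prod.case by (rule continuous_on_norm_Gamma_pow[OF L])
  next
    fix t assume t: "t \<in> set (drop m ls)"
    then show "continuous_on UNIV (\<lambda>y. inverse (norm (case t of (b, B, \<beta>) \<Rightarrow> Gamma_pow L (1 - b) (- B) \<beta> (\<i> * of_real y))))"
      using par set_drop_subset[of m ls]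
      by (cases t) (auto simp: I_parameters_def intro!: continuous_on_inverse_norm_Gamma_pow L)
  next
    fix t assume t: "t \<in> set (drop n us)"
    then show "continuous_on UNIV (\<lambda>y. inverse (norm (case t of (a, A, \<alpha>) \<Rightarrow> Gamma_pow L a A \<alpha> (\<i> * of_real y))))"
      using par set_drop_subset[of n us]
      by (cases t) (auto simp: I_parameters_def intro!: continuous_on_inverse_norm_Gamma_pow L)
  qed
qed

text \<open>
  The orders of growth that occur here are closed under products, inverses and powers, with both
  parameters behaving additively. The factor \<open>pi / 2\<close> is split off so that \<open>q\<close> adds
  up to \<open>I_Delta\<close> and \<open>p\<close> to \<open>I_Omega\<close>.
\<close>

definition decay :: "real \<Rightarrow> real \<Rightarrow> real \<Rightarrow> real" where
  "decay p q y = y powr p * exp (- (pi / 2 * q * y))"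

lemma decay_mult: "decay p q y * decay p' q' y = decay (p + p') (q + q') y"
  by (simp add: decay_def powr_add algebra_simps flip: exp_add)

lemma decay_inverse: "inverse (decay p q y) = decay (- p) (- q) y"
  by (simp add: decay_def powr_minus exp_minus)

lemma decay_powr: "y > 0 \<Longrightarrow> decay p q y powr \<kappa> = decay (\<kappa> * p) (\<kappa> * q) y"
  by (simp add: decay_def powr_mult powr_powr exp_powr_real mult_ac)

text \<open>
  The sign \<open>e\<close> selects the upper or the lower half of the contour. The order is the same on
  both, since only the modulus of the velocity matters.
\<close>

lemma norm_Gamma_pow_bigtheta:
  assumes L: "is_gamma_log L" and d: "d \<noteq> 0" and e: "\<bar>e\<bar> = 1"
  shows "(\<lambda>y. norm (Gamma_pow L c d \<kappa> (\<i> * of_real (e * y)))) \<in>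
           \<Theta>(decay (\<kappa> * (Re c - 1 / 2)) (\<kappa> * \<bar>d\<bar>))"
proof -
  have "d * e \<noteq> 0"
    using d e by auto
  from bigtheta_powr[OF norm_Gamma_line_bigtheta[OF this, of c], of \<kappa>]
  have "(\<lambda>y. norm (Gamma_pow L c d \<kappa> (\<i> * of_real (e * y)))) \<in> \<Theta>(\<lambda>y. \<bar>decay (Re c - 1 / 2) \<bar>d\<bar> y\<bar> powr \<kappa>)"
    unfolding norm_Gamma_pow[OF L imaginary_in_contour] decay_def using e
    by (simp add: abs_mult mult_ac)
  also have "(\<lambda>y. \<bar>decay (Re c - 1 / 2) \<bar>d\<bar> y\<bar> powr \<kappa>) \<in> \<Theta>(decay (\<kappa> * (Re c - 1 / 2)) (\<kappa> * \<bar>d\<bar>))"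
  proof (intro bigthetaI_cong eventually_mono[OF eventually_gt_at_top[of 0]])
    fix y :: real assume "y > 0"
    moreover have "decay (Re c - 1 / 2) \<bar>d\<bar> y \<ge> 0"
      by (simp add: decay_def)
    ultimately show "\<bar>decay (Re c - 1 / 2) \<bar>d\<bar> y\<bar> powr \<kappa> = decay (\<kappa> * (Re c - 1 / 2)) (\<kappa> * \<bar>d\<bar>) y"
      by (simp only: abs_of_nonneg decay_powr)
  qed
  finally show ?thesis .
qed

lemma norm_prod_list_bigtheta:
  fixes g :: "'a \<Rightarrow> real \<Rightarrow> complex"
  assumes "\<And>t. t \<in> set ts \<Longrightarrow> (\<lambda>y. norm (g t y)) \<in> \<Theta>(decay (p t) (q t))"
  shows "(\<lambda>y. norm (\<Prod>t\<leftarrow>ts. g t y)) \<in> \<Theta>(decay (\<Sum>t\<leftarrow>ts. p t) (\<Sum>t\<leftarrow>ts. q t))"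
  using assms
proof (induction ts)
  case Nil
  show ?case
    by (intro bigthetaI_cong eventually_mono[OF eventually_gt_at_top[of 0]]) (simp add: decay_def)
next
  case (Cons t ts)
  then have "(\<lambda>y. norm (g t y) * norm (\<Prod>t\<leftarrow>ts. g t y)) \<in>
      \<Theta>(\<lambda>y. decay (p t) (q t) y * decay (\<Sum>t\<leftarrow>ts. p t) (\<Sum>t\<leftarrow>ts. q t) y)"
    by (intro landau_theta.mult) auto
  then show ?case
    by (simp add: norm_mult decay_mult)
qed

lemma sum_list_take_drop:
  fixes f :: "'a \<Rightarrow> real"
  shows "(\<Sum>t\<leftarrow>ts. f t) = (\<Sum>t\<leftarrow>take k ts. f t) + (\<Sum>t\<leftarrow>drop k ts. f t)"
  by (metis append_take_drop_id map_append sum_list_append)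

text \<open>
  The quantities \<open>I_Omega\<close> and \<open>I_Delta\<close> are, by this lemma, the exponents of the power
  and of the exponential part of the integrand. A triple $(c, d, \kappa)$ enters \<open>I_Omega\<close> with
  $(1/2 - \Re c)\,\kappa$ or its negative according to whether it is an upper or a lower one,
  regardless of whether it stands in the numerator or the denominator: moving it across the fraction
  bar also reflects its argument.
\<close>

lemma norm_I_chi_bigtheta:
  assumes L: "is_gamma_log L" and par: "I_parameters m n us ls" and e: "\<bar>e\<bar> = 1"
  shows "(\<lambda>y. norm (I_chi L m n us ls (\<i> * of_real (e * y)))) \<in>
           \<Theta>(decay (I_Omega us ls) (I_Delta m n us ls))"
proof -
  define w where "w = (\<lambda>(c, d :: real, \<kappa>). (1 / 2 - Re c) * \<kappa> :: real)"
  define r where "r = (\<lambda>(c :: complex, d, \<kappa>). \<kappa> * d :: real)"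
  define s where "s = (\<lambda>y. \<i> * of_real (e * y))"
  have direct: "(\<lambda>y. norm (\<Prod>(c, d, \<kappa>)\<leftarrow>ts. Gamma_pow L c d \<kappa> (s y))) \<in>
      \<Theta>(decay (- (\<Sum>t\<leftarrow>ts. w t)) (\<Sum>t\<leftarrow>ts. r t))"
    if "\<forall>(c, d, \<kappa>)\<in>set ts. d > 0" for ts
  proof -
    have "(\<lambda>y. norm (case t of (c, d, \<kappa>) \<Rightarrow> Gamma_pow L c d \<kappa> (s y))) \<in> \<Theta>(decay (- w t) (r t))"
      if "t \<in> set ts" for t
    proof (cases t)
      case (fields c d \<kappa>)
      with that \<open>\<forall>(c, d, \<kappa>)\<in>set ts. d > 0\<close> have "d > 0" by auto
      then show ?thesis
        using norm_Gamma_pow_bigtheta[OF L _ e, of d c \<kappa>] fields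
        by (simp add: w_def r_def s_def algebra_simps)
    qed
    from norm_prod_list_bigtheta[OF this, of ts] show ?thesis
      by (simp add: uminus_sum_list_map o_def)
  qed
  have reflected: "(\<lambda>y. norm (\<Prod>(c, d, \<kappa>)\<leftarrow>ts. Gamma_pow L (1 - c) (- d) \<kappa> (s y))) \<in>
      \<Theta>(decay (\<Sum>t\<leftarrow>ts. w t) (\<Sum>t\<leftarrow>ts. r t))"
    if "\<forall>(c, d, \<kappa>)\<in>set ts. d > 0" for ts
  proof -
    have "(\<lambda>y. norm (case t of (c, d, \<kappa>) \<Rightarrow> Gamma_pow L (1 - c) (- d) \<kappa> (s y))) \<in> \<Theta>(decay (w t) (r t))"
      if "t \<in> set ts" for t
    proof (cases t)
      case (fields c d \<kappa>)
      with that \<open>\<forall>(c, d, \<kappa>)\<in>set ts. d > 0\<close> have "d > 0" by auto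
      then show ?thesis
        using norm_Gamma_pow_bigtheta[OF L _ e, of "- d" "1 - c" \<kappa>] fields
        by (simp add: w_def r_def s_def algebra_simps)
    qed
    from norm_prod_list_bigtheta[OF this, of ts] show ?thesis by simp
  qed
  have pos: "\<forall>(c, d, \<kappa>)\<in>set (take m ls). d > 0" "\<forall>(c, d, \<kappa>)\<in>set (drop m ls). d > 0"
    "\<forall>(c, d, \<kappa>)\<in>set (take n us). d > 0" "\<forall>(c, d, \<kappa>)\<in>set (drop n us). d > 0"
    using par set_take_subset[of m ls] set_drop_subset[of m ls] set_take_subset[of n us] set_drop_subset[of n us]
    unfolding I_parameters_def by fast+
  have "(\<lambda>y. norm (I_chi L m n us ls (s y))) \<in>
    \<Theta>(\<lambda>y. (decay (- (\<Sum>t\<leftarrow>take m ls. w t)) (\<Sum>t\<leftarrow>take m ls. r t) y *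
            decay (\<Sum>t\<leftarrow>take n us. w t) (\<Sum>t\<leftarrow>take n us. r t) y) /
           (decay (\<Sum>t\<leftarrow>drop m ls. w t) (\<Sum>t\<leftarrow>drop m ls. r t) y *
            decay (- (\<Sum>t\<leftarrow>drop n us. w t)) (\<Sum>t\<leftarrow>drop n us. r t) y))"
    unfolding I_chi_def norm_divide norm_mult
    by (intro bigtheta_divide landau_theta.mult direct reflected pos)
  moreover have "I_Omega us ls = (- (\<Sum>t\<leftarrow>take m ls. w t) + (\<Sum>t\<leftarrow>take n us. w t)) +
      - ((\<Sum>t\<leftarrow>drop m ls. w t) + - (\<Sum>t\<leftarrow>drop n us. w t))"
    unfolding I_Omega_def w_def[symmetric] sum_list_take_drop[of w us n] sum_list_take_drop[of w ls m]
    by simp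
  moreover have "I_Delta m n us ls = ((\<Sum>t\<leftarrow>take m ls. r t) + (\<Sum>t\<leftarrow>take n us. r t)) +
      - ((\<Sum>t\<leftarrow>drop m ls. r t) + (\<Sum>t\<leftarrow>drop n us. r t))"
    unfolding I_Delta_def r_def by simp
  ultimately show ?thesis
    by (simp only: s_def divide_inverse decay_mult decay_inverse)
qed

section \<open>Absolute convergence of the contour integral\<close>

lemma integrable_half_line_if_bigo_powr:
  fixes g :: "real \<Rightarrow> real"
  assumes cont: "continuous_on UNIV g" and p: "p < -1" and g: "g \<in> O(\<lambda>y. y powr p)"
  shows "set_integrable lborel {0..} g"
proof -
  have meas: "g \<in> borel_measurable borel"
    using cont by (rule borel_measurable_continuous_onI)
  obtain C where "eventually (\<lambda>y. norm (g y) \<le> C * norm (y powr p)) at_top"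
    using g by (elim landau_o.bigE)
  then obtain Y where Y: "\<And>y. y \<ge> Y \<Longrightarrow> \<bar>g y\<bar> \<le> C * y powr p"
    by (auto simp: eventually_at_top_linorder)
  define Z where "Z = max Y 1"
  have "(\<lambda>y. y powr p) integrable_on {Z..}"
    by (rule has_integral_integrable[OF has_integral_powr_to_inf[OF p]]) (simp add: Z_def)
  then have "(\<lambda>y. y powr p) absolutely_integrable_on {Z..}"
    by (rule nonnegative_absolutely_integrable_1) simp
  then have "set_integrable lborel {Z..} (\<lambda>y. y powr p)"
    unfolding set_integrable_def by (subst (asm) integrable_completion) auto
  then have "set_integrable lborel {Z..} (\<lambda>y. C * y powr p)"
    by (rule set_integrable_mult_right)
  then have "set_integrable lborel {Z..} g"
  proof (rule set_integrable_bound)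
    show "set_borel_measurable lborel {Z..} g"
      using meas unfolding set_borel_measurable_def by measurable
    have "norm (g y) \<le> norm (C * y powr p)" if "y \<in> {Z..}" for y
      using Y[of y] that by (auto simp: Z_def)
    then show "AE y in lborel. y \<in> {Z..} \<longrightarrow> norm (g y) \<le> norm (C * y powr p)"
      by auto
  qed
  moreover have "set_integrable lborel {0..Z} g"
    using cont by (intro borel_integrable_atLeastAtMost') (auto intro: continuous_on_subset)
  ultimately have "set_integrable lborel ({0..Z} \<union> {Z..}) g"
    by (intro set_integrable_Un) auto
  also have "{0..Z} \<union> {Z..} = {0..}"
    by (auto simp: Z_def)
  finally show ?thesis .
qed

lemma integrable_if_bigo_powr:
  fixes g :: "real \<Rightarrow> real"
  assumes cont: "continuous_on UNIV g" and p: "p < -1"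
    and pos: "g \<in> O(\<lambda>y. y powr p)" and neg: "(\<lambda>y. g (- y)) \<in> O(\<lambda>y. y powr p)"
  shows "integrable lborel g"
proof -
  have "set_integrable lborel {0..} (\<lambda>y. g (- y))"
    using p neg by (intro integrable_half_line_if_bigo_powr continuous_on_compose2[OF cont] continuous_intros) auto
  then have "set_integrable lborel {..0} g"
    unfolding set_integrable_def
    by (subst lborel_integrable_real_affine_iff[where c = "-1" and t = 0, symmetric])
       (auto simp: indicator_def)
  then have "set_integrable lborel ({0..} \<union> {..0}) g"
    using cont p pos by (intro set_integrable_Un integrable_half_line_if_bigo_powr) auto
  also have "{0..} \<union> {..0} = (UNIV :: real set)"
    by auto
  finally show ?thesis
    by (simp add: set_integrable_def)
qed

text \<open>
  The factor \<open>exp (\<theta> * (e * y))\<close> comes from the argument of \<open>z\<close>. If it stays strictly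
  below the decay of the Gamma factors, an exponential gain remains; if it cancels that decay on one
  half of the contour, the condition on \<open>I_Omega\<close> at the point \<open>0\<close> of the contour
  provides a power below \<open>-1\<close>.
\<close>

lemma decay_exp_bigo:
  assumes "I_convergent m n us ls \<theta>" and "\<bar>e\<bar> = 1"
  shows "(\<lambda>y. decay (I_Omega us ls) (I_Delta m n us ls) y * exp (\<theta> * (e * y)))
           \<in> O(\<lambda>y. y powr (if I_Omega us ls < -1 then I_Omega us ls else -2))"
proof -
  define \<Omega> where "\<Omega> = I_Omega us ls"
  define \<delta> where "\<delta> = pi / 2 * I_Delta m n us ls - \<theta> * e"
  have eq: "decay (I_Omega us ls) (I_Delta m n us ls) y * exp (\<theta> * (e * y)) = y powr \<Omega> * exp (- (\<delta> * y))" for y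
    by (simp add: decay_def \<Omega>_def \<delta>_def algebra_simps flip: exp_add)
  have "\<theta> * e \<le> \<bar>\<theta>\<bar>"
    using assms(2) by (metis abs_ge_self abs_mult mult.right_neutral)
  moreover have "0 \<in> contour"
    by (simp add: contour_def)
  ultimately have sign: "\<delta> > 0 \<or> \<delta> \<ge> 0 \<and> \<Omega> < -1"
    using assms(1) unfolding I_convergent_def Let_def \<Omega>_def \<delta>_def by force
  show ?thesis
    unfolding eq unfolding \<Omega>_def[symmetric]
  proof (cases "\<Omega> < -1")
    case True
    then have "\<delta> \<ge> 0"
      using sign by auto
    then have "(\<lambda>y. y powr \<Omega> * exp (- (\<delta> * y))) \<in> O(\<lambda>y. y powr \<Omega>)"
      by (intro landau_o.bigI[where c = 1] eventually_mono[OF eventually_ge_at_top[of 0]])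
         (auto intro: mult_left_le)
    with True show "(\<lambda>y. y powr \<Omega> * exp (- (\<delta> * y))) \<in> O(\<lambda>y. y powr (if \<Omega> < -1 then \<Omega> else -2))"
      by simp
  next
    case False
    then have "\<delta> > 0"
      using sign by auto
    then have "(\<lambda>y. y powr \<Omega> * exp (- (\<delta> * y))) \<in> O(\<lambda>y. y powr -2)"
      by real_asymp
    with False show "(\<lambda>y. y powr \<Omega> * exp (- (\<delta> * y))) \<in> O(\<lambda>y. y powr (if \<Omega> < -1 then \<Omega> else -2))"
      by simp
  qed
qed

text \<open>
  Absolute convergence of the contour integral. For real \<open>r\<close> the term with \<open>r\<close>
  contributes a factor of modulus \<open>1\<close>, so the same bound serves every modulus of \<open>z\<close>;
  this uniformity is what permits the interchange of integrals.
\<close>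

lemma integrable_I_chi:
  assumes L: "is_gamma_log L" and adm: "I_admissible m n us ls \<theta>"
  shows "integrable lborel (\<lambda>y. I_chi L m n us ls (\<i> * of_real y) *
           exp (- (\<i> * of_real y) * (of_real r + \<i> * of_real \<theta>)))"
proof -
  have par: "I_parameters m n us ls" and sep: "I_separated m n us ls" and conv: "I_convergent m n us ls \<theta>"
    using adm by (auto simp: I_admissible_def)
  define g where "g = (\<lambda>y. norm (I_chi L m n us ls (\<i> * of_real y)) * exp (\<theta> * y))"
  \<comment> \<open>In the second case the decay is exponential, and any exponent below \<open>-1\<close> would do in place of \<open>-2\<close>.\<close>
  define p where "p = (if I_Omega us ls < -1 then I_Omega us ls else -2)"
  have end_bound: "(\<lambda>y. g (e * y)) \<in> O(\<lambda>y. y powr p)" if e: "\<bar>e\<bar> = 1" for e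
  proof -
    have "(\<lambda>y. g (e * y)) \<in> \<Theta>(\<lambda>y. decay (I_Omega us ls) (I_Delta m n us ls) y * exp (\<theta> * (e * y)))"
      unfolding g_def by (intro landau_theta.mult norm_I_chi_bigtheta[OF L par e]) simp
    also have "(\<lambda>y. decay (I_Omega us ls) (I_Delta m n us ls) y * exp (\<theta> * (e * y))) \<in> O(\<lambda>y. y powr p)"
      unfolding p_def by (rule decay_exp_bigo[OF conv e])
    finally show ?thesis .
  qed
  have "integrable lborel g"
  proof (rule integrable_if_bigo_powr)
    show "continuous_on UNIV g"
      unfolding g_def by (intro continuous_intros continuous_on_norm_I_chi L par sep)
    show "p < -1"
      by (simp add: p_def)
    show "g \<in> O(\<lambda>y. y powr p)" "(\<lambda>y. g (- y)) \<in> O(\<lambda>y. y powr p)"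
      using end_bound[of 1] end_bound[of "-1"] by simp_all
  qed
  then show ?thesis
  proof (rule Bochner_Integration.integrable_bound)
    note I_chi_measurable[OF L, measurable]
    show "(\<lambda>y. I_chi L m n us ls (\<i> * of_real y) *
           exp (- (\<i> * of_real y) * (of_real r + \<i> * of_real \<theta>))) \<in> borel_measurable lborel"
      by measurable
    show "AE y in lborel. norm (I_chi L m n us ls (\<i> * of_real y) *
           exp (- (\<i> * of_real y) * (of_real r + \<i> * of_real \<theta>))) \<le> norm (g y)"
      by (simp add: g_def norm_mult mult.commute)
  qed
qed

section \<open>Fractional integration under the contour integral\<close>

text \<open>
  For exponent \<open>1\<close> no choice of branch remains. Hence the factors that the fractional integral
  adds to the integrand are plain Gamma functions, whatever \<open>L\<close> is.
\<close>

lemma Gamma_pow_1: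
  assumes L: "is_gamma_log L" and s: "s \<in> contour"
  shows "Gamma_pow L c d 1 s = Gamma (c + of_real d * s)"
proof (cases "c + of_real d * s \<in> \<int>\<^sub>\<le>\<^sub>0")
  case True
  then show ?thesis
    by (simp add: Gamma_pow_def Gamma_eq_zero_iff)
next
  case False
  then show ?thesis
    using L s unfolding is_gamma_log_def Let_def by (auto simp: Gamma_pow_def)
qed

lemma I_chi_extend:
  assumes "is_gamma_log L" and "s \<in> contour" and "m \<le> length ls"
  shows "I_chi L m (n + 1) ((u, A, 1) # us) (ls @ [(v, B, 1)]) s =
           I_chi L m n us ls s * (Gamma (1 - u - of_real A * s) / Gamma (1 - v - of_real B * s))"
  using assms by (simp add: I_chi_def Gamma_pow_1 mult_ac)

text \<open>
  Passing from \<open>a\<close> to $a t^{-\mu}$ multiplies the integrand by the unimodular factor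
  $t^{\mu s}$ and leaves everything else unchanged.
\<close>

lemma I_function_power_argument:
  assumes "a \<noteq> 0" and "t > 0"
  shows "I_function L m n us ls (a * of_real (t powr (- \<mu>))) \<theta> =
           1 / (2 * of_real pi) *
           (\<integral>y. I_chi L m n us ls (\<i> * of_real y) *
                 exp (- (\<i> * of_real y) * (of_real (ln (norm a)) + \<i> * of_real \<theta>)) *
                 exp (\<i> * of_real (\<mu> * y * ln t)) \<partial>lborel)"
proof -
  have ln_eq: "ln (norm (a * of_real (t powr (- \<mu>)))) = ln (norm a) - \<mu> * ln t"
    using assms by (simp add: norm_mult ln_mult)
  have "exp (- (\<i> * of_real y) * (of_real (ln (norm (a * of_real (t powr (- \<mu>))))) + \<i> * of_real \<theta>)) =
      exp (- (\<i> * of_real y) * (of_real (ln (norm a)) + \<i> * of_real \<theta>)) * exp (\<i> * of_real (\<mu> * y * ln t))" for y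
    unfolding ln_eq by (simp add: algebra_simps flip: exp_add)
  then show ?thesis
    unfolding I_function_def Let_def by (simp only: mult.assoc[symmetric] integral_mult_left_zero) simp
qed

text \<open>
  The interchange of the fractional integral with the contour integral. The double integrand is
  dominated by the product of the absolute values of the Beta kernel and of \<open>h\<close>, because the
  oscillating factor that couples the two variables has modulus \<open>1\<close>. For fixed \<open>y\<close> this
  factor turns \<open>w\<close> into $w - i\mu y$ and the inner integral into a Beta integral again.
\<close>

lemma has_bochner_integral_Beta_superposition:
  fixes h :: "real \<Rightarrow> complex" and \<alpha> w :: complex and \<mu> x :: real
  assumes h: "integrable lborel h"
    and \<alpha>: "Re \<alpha> > 0" and w: "Re w > 0" and x: "x > 0"
  shows "has_bochner_integral lborel
           (\<lambda>t. indicator {x<..} t *\<^sub>R (of_real (t - x) powr (\<alpha> - 1) * of_real t powr (- \<alpha> - w)) *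
                (\<integral>y. h y * exp (\<i> * of_real (\<mu> * y * ln t)) \<partial>lborel))
           (Gamma \<alpha> * of_real x powr (- w) *
            (\<integral>y. h y * exp (\<i> * of_real (\<mu> * y * ln x)) *
                  (Gamma (w - of_real \<mu> * (\<i> * of_real y)) /
                   Gamma (\<alpha> + w - of_real \<mu> * (\<i> * of_real y))) \<partial>lborel))"
proof -
  let ?k = "\<lambda>t. indicator {x<..} t *\<^sub>R (of_real (t - x) powr (\<alpha> - 1) * of_real t powr (- \<alpha> - w)) :: complex"
  define G where "G = (\<lambda>t y. ?k t * (h y * exp (\<i> * of_real (\<mu> * y * ln t))))"
  have k: "integrable lborel ?k"
    using has_bochner_integral_Beta_right[OF \<alpha> w x] by (simp add: has_bochner_integral_iff)
  have [measurable]: "h \<in> borel_measurable lborel"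
    using h by simp
  have int_y: "integrable lborel (\<lambda>y. h y * exp (\<i> * of_real (\<mu> * y * ln t)))" for t
    using h by (rule Bochner_Integration.integrable_bound) (auto simp: norm_mult)
  have inner_t: "(\<integral>t. G t y \<partial>lborel) = Gamma \<alpha> * of_real x powr (- w) *
      (h y * exp (\<i> * of_real (\<mu> * y * ln x)) *
        (Gamma (w - of_real \<mu> * (\<i> * of_real y)) / Gamma (\<alpha> + w - of_real \<mu> * (\<i> * of_real y))))" for y
  proof -
    define w' where "w' = w - of_real \<mu> * (\<i> * of_real y)"
    have powr_shift: "of_real t powr (c - w') = of_real t powr (c - w) * exp (\<i> * of_real (\<mu> * y * ln t))"
      if "t > 0" for t :: real and c
      using that by (simp add: w'_def powr_def Ln_of_real algebra_simps flip: exp_add)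
    have "G t y = h y * (indicator {x<..} t *\<^sub>R (of_real (t - x) powr (\<alpha> - 1) * of_real t powr (- \<alpha> - w')))" for t
      using x by (cases "t > x") (simp_all add: G_def powr_shift)
    then have "(\<integral>t. G t y \<partial>lborel) =
        h y * (\<integral>t. indicator {x<..} t *\<^sub>R (of_real (t - x) powr (\<alpha> - 1) * of_real t powr (- \<alpha> - w')) \<partial>lborel)"
      by (simp only: integral_mult_right_zero)
    also have "\<dots> = h y * (of_real x powr (- w') * (Gamma \<alpha> * Gamma w' / Gamma (\<alpha> + w')))"
      using has_bochner_integral_Beta_right[OF \<alpha> _ x, of w'] w
      by (simp only: has_bochner_integral_iff) (simp add: w'_def)
    also have "of_real x powr (- w') = of_real x powr (- w) * exp (\<i> * of_real (\<mu> * y * ln x))"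
      using powr_shift[OF x, of 0] by simp
    finally show ?thesis
      by (simp add: w'_def add_diff_eq mult_ac)
  qed
  have [measurable]: "case_prod G \<in> borel_measurable (lborel \<Otimes>\<^sub>M lborel)"
    unfolding G_def by measurable
  have int: "integrable (lborel \<Otimes>\<^sub>M lborel) (case_prod G)"
  proof (rule lborel_pair.Fubini_integrable)
    have "(\<integral>y. norm (G t y) \<partial>lborel) = norm (?k t) * (\<integral>y. norm (h y) \<partial>lborel)" for t
      unfolding G_def norm_mult norm_exp_i_times mult_1_right by (rule integral_mult_right_zero)
    then show "integrable lborel (\<lambda>t. \<integral>y. norm (case_prod G (t, y)) \<partial>lborel)"
      unfolding prod.case using k by (simp only:) (intro integrable_mult_left integrable_norm)
    show "AE t in lborel. integrable lborel (\<lambda>y. case_prod G (t, y))"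
      unfolding prod.case G_def using int_y by (intro always_eventually allI integrable_mult_right)
  qed auto
  have inner_y: "(\<integral>y. G t y \<partial>lborel) = ?k t * (\<integral>y. h y * exp (\<i> * of_real (\<mu> * y * ln t)) \<partial>lborel)" for t
    unfolding G_def by (rule integral_mult_right_zero)
  have "has_bochner_integral lborel (\<lambda>t. \<integral>y. G t y \<partial>lborel) (\<integral>t. (\<integral>y. G t y \<partial>lborel) \<partial>lborel)"
    using lborel_pair.integrable_fst[OF int] by (rule has_bochner_integral_integrable)
  also have "(\<integral>t. (\<integral>y. G t y \<partial>lborel) \<partial>lborel) = (\<integral>y. (\<integral>t. G t y \<partial>lborel) \<partial>lborel)"
    using lborel_pair.Fubini_integral[OF int] by simp
  finally show ?thesis
    unfolding inner_y inner_t integral_mult_right_zero .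
qed

theorem corollary3p4:
  fixes \<alpha> \<gamma> \<rho> a :: complex and \<mu> \<theta> x :: real
    and m n :: nat and us ls :: "triple list" and L :: gamma_log
  assumes "a \<noteq> 0" and "is_Arg a \<theta>"
    and "is_gamma_log L"
    and "Re \<alpha> > 0" and "\<mu> > 0" and "Re \<rho> > max 0 (Re (- \<gamma>))"
    and "I_admissible m n us ls \<theta>"
    and "I_admissible m (n + 1) ((1 - \<gamma> - \<rho>, \<mu>, 1) # us) (ls @ [(1 - \<alpha> - \<gamma> - \<rho>, \<mu>, 1)]) \<theta>"
    and "x > 0"
  defines "f \<equiv> (\<lambda>t::real. of_real t powr (- \<rho>) *
                  I_function L m n us ls (a * of_real (t powr (- \<mu>))) \<theta>)"
  shows "erdelyi_kober_right_exists \<gamma> \<alpha> f x \<and>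
         erdelyi_kober_right \<gamma> \<alpha> f x =
           of_real x powr (- \<rho>) *
           I_function L m (n + 1) ((1 - \<gamma> - \<rho>, \<mu>, 1) # us) (ls @ [(1 - \<alpha> - \<gamma> - \<rho>, \<mu>, 1)])
             (a * of_real (x powr (- \<mu>))) \<theta>"
proof -
  define w where "w = \<gamma> + \<rho>"
  define h where "h = (\<lambda>y. I_chi L m n us ls (\<i> * of_real y) *
      exp (- (\<i> * of_real y) * (of_real (ln (norm a)) + \<i> * of_real \<theta>)))"
  define J where "J = (\<integral>y. h y * exp (\<i> * of_real (\<mu> * y * ln x)) *
      (Gamma (w - of_real \<mu> * (\<i> * of_real y)) / Gamma (\<alpha> + w - of_real \<mu> * (\<i> * of_real y))) \<partial>lborel)"
  define c where "c = of_real x powr \<gamma> / (2 * of_real pi)"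
  let ?k = "\<lambda>t. indicator {x<..} t *\<^sub>R (of_real (t - x) powr (\<alpha> - 1) * of_real t powr (- \<alpha> - w)) :: complex"
  have Re_w: "Re w > 0"
    using assms(6) by (simp add: w_def)
  have h: "integrable lborel h"
    unfolding h_def by (rule integrable_I_chi) fact+
  have integrand: "indicator {x<..} t *\<^sub>R saigo_right_integrand \<alpha> 0 \<gamma> f x t =
      c * (?k t * (\<integral>y. h y * exp (\<i> * of_real (\<mu> * y * ln t)) \<partial>lborel))" for t
  proof (cases "t > x")
    case True
    then have t: "t > 0" "0 \<le> 1 - x / t" "1 - x / t < 1"
      using \<open>x > 0\<close> by auto
    have "norm (complex_of_real (1 - x / t)) < 1"
      unfolding norm_of_real using t by linarith
    then have "hyp2F1 \<alpha> (- \<gamma>) \<alpha> (of_real (1 - x / t)) = of_real (x / t) powr \<gamma>"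
      using hyp2F1_cancel[OF not_nonpos_Int_if_Re_pos[OF \<open>Re \<alpha> > 0\<close>], of "of_real (1 - x / t)" "- \<gamma>"]
      by simp
    also have "\<dots> = of_real x powr \<gamma> * of_real t powr (- \<gamma>)"
      using t \<open>x > 0\<close> by (simp add: powr_def Ln_of_real ln_div algebra_simps flip: exp_add of_real_divide)
    finally have hyp: "hyp2F1 \<alpha> (- \<gamma>) \<alpha> (of_real (1 - x / t)) = of_real x powr \<gamma> * of_real t powr (- \<gamma>)" .
    have exponents: "of_real t powr (- \<alpha> - w) = of_real t powr (- \<alpha>) * (of_real t powr (- \<gamma>) * of_real t powr (- \<rho>))"
      by (simp add: w_def algebra_simps flip: powr_add)
    show ?thesis
      using True
      by (simp add: saigo_right_integrand_def f_def hyp exponents c_def h_def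
          I_function_power_argument[OF \<open>a \<noteq> 0\<close> t(1)] del: of_real_diff)
  qed simp
  have "has_bochner_integral lborel (\<lambda>t. indicator {x<..} t *\<^sub>R saigo_right_integrand \<alpha> 0 \<gamma> f x t)
      (c * (Gamma \<alpha> * of_real x powr (- w) * J))"
    unfolding integrand J_def
    by (intro has_bochner_integral_mult_right has_bochner_integral_Beta_superposition h Re_w)
       (use assms in auto)
  then have exists: "erdelyi_kober_right_exists \<gamma> \<alpha> f x"
    and val: "erdelyi_kober_right \<gamma> \<alpha> f x = 1 / Gamma \<alpha> * (c * (Gamma \<alpha> * of_real x powr (- w) * J))"
    unfolding erdelyi_kober_right_exists_def erdelyi_kober_right_def saigo_right_exists_def saigo_right_def
      set_integrable_def set_lebesgue_integral_def has_bochner_integral_iff by auto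
  have "Gamma \<alpha> \<noteq> 0"
    using not_nonpos_Int_if_Re_pos[OF \<open>Re \<alpha> > 0\<close>] by (simp add: Gamma_eq_zero_iff)
  then have "erdelyi_kober_right \<gamma> \<alpha> f x = (of_real x powr \<gamma> * of_real x powr (- w)) * (1 / (2 * of_real pi) * J)"
    unfolding val c_def by simp
  also have "of_real x powr \<gamma> * of_real x powr (- w) = of_real x powr (- \<rho>)"
    by (simp add: w_def flip: powr_add)
  also have "1 / (2 * of_real pi) * J = I_function L m (n + 1) ((1 - \<gamma> - \<rho>, \<mu>, 1) # us)
      (ls @ [(1 - \<alpha> - \<gamma> - \<rho>, \<mu>, 1)]) (a * of_real (x powr (- \<mu>))) \<theta>"
  proof -
    have "m \<le> length ls"
      using assms(7) by (simp add: I_admissible_def I_parameters_def)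
    then show ?thesis
      unfolding I_function_power_argument[OF \<open>a \<noteq> 0\<close> \<open>x > 0\<close>] J_def h_def
        I_chi_extend[OF \<open>is_gamma_log L\<close> imaginary_in_contour \<open>m \<le> length ls\<close>]
      by (simp add: w_def algebra_simps)
  qed
  finally show ?thesis
    using exists by simp
qed

end
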